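(* Let \[K=\langle a,c,d,t,u \mid t^2=u^2=(tu)^4=1,\ ad=da,\ c=a^2,\ tat=a^{-1}d,\ uau=a,\ udu=d\rangle\cong\mathbb{Z}^2\rtimes D_8,\] with generating set $X'=\{a^{\pm1},c^{\pm1},d^{\pm1},t,u\}$. Then $\mathsf{Geo}(K,X')$ and $\mathsf{ConjGeo}(K,X')$ are not regular. Moreover, if the set $X'$ is ordered by $a<c<a^{-1}<c^{-1}<d<d^{-1}<t<u$, then none of the languages $\mathsf{SL}(K,X')$, $\mathsf{ConjMinLenSL}(K,X')$ and $\mathsf{ConjSL}(K,X')$ is regular.
   Context: $D_8$ is the dihedral group of order 8. For $w\in X'^*$, $l(w)$ is its length and $\pi(w)$ the element of $K$ it represents. For $g\in K$, $|g|$ is the length of a shortest word over $X'$ representing $g$, and $|g|_c=\min\{|h| : h\text{ conjugate to }g\text{ in }K\}$. $\mathsf{Geo}(K,X')=\{w : l(w)=|\pi(w)|\}$ and $\mathsf{ConjGeo}(K,X')=\{w : l(w)=|\pi(w)|_c\}$. The shortlex ordering on $X'^*$ compares words first by length and then, for equal length, lexicographically; $y_g$ denotes the shortlex least word representing $g\in K$, and $z_\kappa$ the shortlex least word representing an element of the conjugacy class $\kappa$. $\mathsf{SL}(K,X')=\{y_g : g\in K\}$, $\mathsf{ConjMinLenSL}(K,X')=\{y_g : g\in K,\ |g|=|g|_c\}$ and $\mathsf{ConjSL}(K,X')=\{z_\kappa : \kappa\text{ a conjugacy class of }K\}$. A language is regular if it is accepted by a finite state automaton. *)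

theory Defs
  imports "HOL-Algebra.Bij" "HOL-Algebra.Elementary_Groups"
begin

section \<open>Groups given by presentations\<close>

text \<open>
  Words over the generators and their formal inverses: \<open>(x, True)\<close> stands for the generator
  \<open>x\<close> and \<open>(x, False)\<close> for its formal inverse.  A relation \<open>u = v\<close> is the pair \<open>(u, v)\<close>.
  The group \<open>\<langle>X | R\<rangle>\<close> is the quotient of the monoid of such words by the least
  congruence that contains \<open>R\<close> and cancels adjacent inverse letters.  The generating set is
  the whole type \<^typ>\<open>'x\<close>.
\<close>

type_synonym 'x gword = "('x \<times> bool) list"

inductive pres_eq :: "('x gword \<times> 'x gword) set \<Rightarrow> 'x gword \<Rightarrow> 'x gword \<Rightarrow> bool"
  for R :: "('x gword \<times> 'x gword) set" where
  pres_cancel: "pres_eq R [(x, b), (x, \<not> b)] []"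
| pres_rel: "(u, v) \<in> R \<Longrightarrow> pres_eq R u v"
| pres_refl: "pres_eq R u u"
| pres_sym: "pres_eq R u v \<Longrightarrow> pres_eq R v u"
| pres_trans: "pres_eq R u v \<Longrightarrow> pres_eq R v w \<Longrightarrow> pres_eq R u w"
| pres_append: "pres_eq R u u' \<Longrightarrow> pres_eq R v v' \<Longrightarrow> pres_eq R (u @ v) (u' @ v')"

definition pres_class :: "('x gword \<times> 'x gword) set \<Rightarrow> 'x gword \<Rightarrow> 'x gword set" where
  "pres_class R u = {v. pres_eq R u v}"

definition presented_group :: "('x gword \<times> 'x gword) set \<Rightarrow> 'x gword set monoid" where
  "presented_group R =
    \<lparr>carrier = range (pres_class R),
     mult = (\<lambda>A B. {w. \<exists>u\<in>A. \<exists>v\<in>B. pres_eq R (u @ v) w}),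
     one = pres_class R []\<rparr>"

lemma pres_class_eq_iff: "pres_class R u = pres_class R v \<longleftrightarrow> pres_eq R u v"
  unfolding pres_class_def by (blast intro: pres_refl pres_sym pres_trans)

lemma carrier_presented_group [simp]: "carrier (presented_group R) = range (pres_class R)"
  and one_presented_group [simp]: "\<one>\<^bsub>presented_group R\<^esub> = pres_class R []"
  by (simp_all add: presented_group_def)

lemma mult_presented_group [simp]:
  "pres_class R u \<otimes>\<^bsub>presented_group R\<^esub> pres_class R v = pres_class R (u @ v)"
  unfolding presented_group_def pres_class_def
  by (auto intro: pres_refl pres_append pres_trans)

lemma pres_eq_inverse: "pres_eq R (rev (map (\<lambda>(x, b). (x, \<not> b)) u) @ u) []"
proof (induction u)
  case Nil
  show ?case by (simp add: pres_refl)
next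
  case (Cons p u)
  obtain x b where p: "p = (x, b)" by (cases p)
  let ?v = "rev (map (\<lambda>(x, b). (x, \<not> b)) u)"
  have "pres_eq R [(x, \<not> b), (x, b)] []"
    using pres_cancel[of R x "\<not> b"] by simp
  then have "pres_eq R ([(x, \<not> b), (x, b)] @ u) ([] @ u)"
    by (rule pres_append[OF _ pres_refl])
  then have "pres_eq R (?v @ [(x, \<not> b), (x, b)] @ u) (?v @ [] @ u)"
    by (rule pres_append[OF pres_refl])
  then have "pres_eq R (?v @ [(x, \<not> b), (x, b)] @ u) []"
    using Cons.IH by (auto intro: pres_trans)
  then show ?case by (simp add: p)
qed

lemma group_presented_group: "group (presented_group R)"
proof (rule groupI)
  fix g assume "g \<in> carrier (presented_group R)"
  then obtain u where g: "g = pres_class R u" by auto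
  have "pres_class R (rev (map (\<lambda>(x, b). (x, \<not> b)) u)) \<otimes>\<^bsub>presented_group R\<^esub> g
      = \<one>\<^bsub>presented_group R\<^esub>"
    by (simp add: g pres_class_eq_iff pres_eq_inverse)
  then show "\<exists>h\<in>carrier (presented_group R).
      h \<otimes>\<^bsub>presented_group R\<^esub> g = \<one>\<^bsub>presented_group R\<^esub>"
    by auto
qed auto


section \<open>Semidirect products and dihedral groups\<close>

text \<open>Here \<open>\<phi>\<close> is meant to be a homomorphism from \<open>H\<close> to \<open>AutoGroup N\<close>.\<close>

definition semidirect_product ::
    "('n, 'c) monoid_scheme \<Rightarrow> ('h \<Rightarrow> 'n \<Rightarrow> 'n) \<Rightarrow> ('h, 'd) monoid_scheme \<Rightarrow> ('n \<times> 'h) monoid" where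
  "semidirect_product N \<phi> H =
    \<lparr>carrier = carrier N \<times> carrier H,
     mult = (\<lambda>(n, h) (n', h'). (n \<otimes>\<^bsub>N\<^esub> \<phi> h n', h \<otimes>\<^bsub>H\<^esub> h')),
     one = (\<one>\<^bsub>N\<^esub>, \<one>\<^bsub>H\<^esub>)\<rparr>"

text \<open>The dihedral group of order \<open>2 * n\<close>, so that \<open>D\<^sub>8\<close> is \<open>dihedral_group 4\<close>.\<close>

definition dihedral_group :: "nat \<Rightarrow> (int \<times> int) monoid" where
  "dihedral_group n =
    semidirect_product (integer_mod_group n)
      (\<lambda>j. \<lambda>k\<in>carrier (integer_mod_group n). if j = 0 then k else inv\<^bsub>integer_mod_group n\<^esub> k)
      (integer_mod_group 2)"


section \<open>Regular languages\<close>

text \<open>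
  Finite deterministic automata over the alphabet \<open>X\<close>.  Taking the states to be natural numbers
  is no restriction, because the set of states is finite.
\<close>

definition regular_language :: "'x set \<Rightarrow> 'x list set \<Rightarrow> bool" where
  "regular_language X L \<longleftrightarrow>
    (\<exists>(Q :: nat set) \<delta> q\<^sub>0 F.
      finite Q \<and> q\<^sub>0 \<in> Q \<and> F \<subseteq> Q \<and> (\<forall>q\<in>Q. \<forall>x\<in>X. \<delta> q x \<in> Q) \<and>
      L = {w \<in> lists X. foldl \<delta> q\<^sub>0 w \<in> F})"


section \<open>Geodesic and conjugacy languages of a group\<close>

text \<open>
  In the following, \<open>X\<close> is a set of elements of the group \<open>G\<close> that generates \<open>G\<close> as a monoid,
  words over \<open>X\<close> are the members of \<open>lists X\<close>, and \<open>r\<close> is a strict linear order on \<open>X\<close>.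
\<close>

definition word_value :: "('g, 'c) monoid_scheme \<Rightarrow> 'g list \<Rightarrow> 'g" where
  "word_value G w = foldr (\<lambda>x g. x \<otimes>\<^bsub>G\<^esub> g) w \<one>\<^bsub>G\<^esub>"

definition word_length :: "('g, 'c) monoid_scheme \<Rightarrow> 'g set \<Rightarrow> 'g \<Rightarrow> nat" where
  "word_length G X g = (LEAST n. \<exists>w\<in>lists X. word_value G w = g \<and> length w = n)"

definition conj_class :: "('g, 'c) monoid_scheme \<Rightarrow> 'g \<Rightarrow> 'g set" where
  "conj_class G g = {x \<otimes>\<^bsub>G\<^esub> g \<otimes>\<^bsub>G\<^esub> inv\<^bsub>G\<^esub> x | x. x \<in> carrier G}"

definition conj_length :: "('g, 'c) monoid_scheme \<Rightarrow> 'g set \<Rightarrow> 'g \<Rightarrow> nat" where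
  "conj_length G X g = (LEAST n. \<exists>h\<in>conj_class G g. word_length G X h = n)"

definition Geo :: "('g, 'c) monoid_scheme \<Rightarrow> 'g set \<Rightarrow> 'g list set" where
  "Geo G X = {w \<in> lists X. length w = word_length G X (word_value G w)}"

definition ConjGeo :: "('g, 'c) monoid_scheme \<Rightarrow> 'g set \<Rightarrow> 'g list set" where
  "ConjGeo G X = {w \<in> lists X. length w = conj_length G X (word_value G w)}"

text \<open>
  The shortlex ordering is \<^term>\<open>lenlex r\<close>.  The word below is the shortlex least word over \<open>X\<close>
  representing an element of \<open>S\<close>; it is \<open>y\<^sub>g\<close> for \<open>S = {g}\<close> and \<open>z\<^sub>\<kappa>\<close> for \<open>S = \<kappa>\<close>.
\<close>

definition shortlex_least ::
    "('g, 'c) monoid_scheme \<Rightarrow> 'g set \<Rightarrow> ('g \<times> 'g) set \<Rightarrow> 'g set \<Rightarrow> 'g list" where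
  "shortlex_least G X r S =
    (THE w. w \<in> lists X \<and> word_value G w \<in> S \<and>
      (\<forall>v\<in>lists X. word_value G v \<in> S \<and> v \<noteq> w \<longrightarrow> (w, v) \<in> lenlex r))"

definition SL :: "('g, 'c) monoid_scheme \<Rightarrow> 'g set \<Rightarrow> ('g \<times> 'g) set \<Rightarrow> 'g list set" where
  "SL G X r = {shortlex_least G X r {g} | g. g \<in> carrier G}"

definition ConjMinLenSL :: "('g, 'c) monoid_scheme \<Rightarrow> 'g set \<Rightarrow> ('g \<times> 'g) set \<Rightarrow> 'g list set" where
  "ConjMinLenSL G X r =
    {shortlex_least G X r {g} | g. g \<in> carrier G \<and> word_length G X g = conj_length G X g}"

definition ConjSL :: "('g, 'c) monoid_scheme \<Rightarrow> 'g set \<Rightarrow> ('g \<times> 'g) set \<Rightarrow> 'g list set" where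
  "ConjSL G X r = {shortlex_least G X r \<kappa> | \<kappa>. \<kappa> \<in> conj_class G ` carrier G}"

text \<open>The strict order in which the entries of a list (without repetitions) are increasing.\<close>

definition list_order :: "'x list \<Rightarrow> ('x \<times> 'x) set" where
  "list_order xs = {(xs ! i, xs ! j) | i j. i < j \<and> j < length xs}"


section \<open>The group \<open>K\<close>\<close>

datatype K_gen = gen_a | gen_c | gen_d | gen_t | gen_u

definition K_relations :: "(K_gen gword \<times> K_gen gword) set" where
  "K_relations =
    (let a = [(gen_a, True)]; a' = [(gen_a, False)]; c = [(gen_c, True)]; d = [(gen_d, True)];
         t = [(gen_t, True)]; u = [(gen_u, True)]
     in {(t @ t, []),
         (u @ u, []),
         (concat (replicate 4 (t @ u)), []),
         (a @ d, d @ a),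
         (c, a @ a),
         (t @ a @ t, a' @ d),
         (u @ a @ u, a),
         (u @ d @ u, d)})"

definition K_group :: "K_gen gword set monoid" where
  "K_group = presented_group K_relations"

definition K_elem :: "K_gen \<Rightarrow> K_gen gword set" where
  "K_elem x = pres_class K_relations [(x, True)]"

text \<open>The generating set \<open>X'\<close>, listed in the order \<open>a < c < a\<inverse> < c\<inverse> < d < d\<inverse> < t < u\<close>.\<close>

definition K_letters :: "K_gen gword set list" where
  "K_letters =
    [K_elem gen_a, K_elem gen_c, inv\<^bsub>K_group\<^esub> K_elem gen_a, inv\<^bsub>K_group\<^esub> K_elem gen_c,
     K_elem gen_d, inv\<^bsub>K_group\<^esub> K_elem gen_d, K_elem gen_t, K_elem gen_u]"

definition K_genset :: "K_gen gword set set" where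
  "K_genset = set K_letters"

end

theory Submission
  imports Defs
begin

text \<open>
  The relations say that \<open>d = ab\<close> with \<open>b = tat\<close>, that \<open>t\<close> swaps \<open>a\<close> and \<open>b\<close>, and that \<open>u\<close>
  commutes with \<open>a\<close> and \<open>b\<close>.  To spell \<open>a\<^sup>x b\<^sup>y u\<close> one either avoids \<open>t\<close>, at the
  cost of \<open>\<bar>y\<bar>\<close> letters \<open>d\<close>, or pays two letters \<open>t\<close> in order to produce \<open>b\<^sup>2\<close> as \<open>tct\<close>.  For
  \<open>c\<^sup>n t c\<^sup>m t u\<close>, which represents \<open>a\<^bsup>2n\<^esup> b\<^bsup>2m\<^esup> u\<close>, the detour through \<open>t\<close> is worthwhile iff \<open>m > n\<close>:
  for \<open>m \<le> n\<close> the word \<open>d\<^bsup>2m\<^esup> c\<^bsup>n-m\<^esup> u\<close> is shorter, and for \<open>m \<ge> n + 2\<close> the word is shortlex least for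
  its element.  The only other kind of conjugate is \<open>a\<^bsup>2m\<^esup> b\<^bsup>2n\<^esup> tut\<close>, whose spellings must contain \<open>t\<close>
  and which is never shorter; its shortlex least word \<open>c\<^sup>m t c\<^sup>n u t\<close> is the one for the conjugacy
  class.  A finite automaton cannot compare \<open>m\<close> with \<open>n\<close>.
\<close>

section \<open>Regular languages and shortlex orderings\<close>

text \<open>The pigeonhole half of Myhill-Nerode: the states reached after the prefixes
  \<open>p i\<close> lie in a finite set, so two prefixes reach the same state and no suffix can
  separate them.\<close>

lemma not_regular_language:
  fixes p :: "nat \<Rightarrow> 'x list"
  assumes distinguishing: "\<And>i j. i < j \<Longrightarrow>
      \<exists>s. p i @ s \<in> lists X \<and> p j @ s \<in> lists X \<and> (p i @ s \<in> L \<longleftrightarrow> p j @ s \<notin> L)"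
  shows "\<not> regular_language X L"
proof
  assume "regular_language X L"
  then obtain Q :: "nat set" and \<delta> q0 F where "finite Q" "q0 \<in> Q"
    and closed: "\<forall>q\<in>Q. \<forall>x\<in>X. \<delta> q x \<in> Q"
    and L: "L = {w \<in> lists X. foldl \<delta> q0 w \<in> F}"
    unfolding regular_language_def by blast
  have reach: "w \<in> lists X \<Longrightarrow> q \<in> Q \<Longrightarrow> foldl \<delta> q w \<in> Q" for w q
    using closed by (induction w arbitrary: q) auto
  have "p i \<in> lists X" for i
    using distinguishing[of i "Suc i"] by auto
  then have "range (\<lambda>i. foldl \<delta> q0 (p i)) \<subseteq> Q"
    using reach \<open>q0 \<in> Q\<close> by blast
  then have "\<not> inj (\<lambda>i. foldl \<delta> q0 (p i))"
    using \<open>finite Q\<close> finite_subset infinite_UNIV_nat finite_imageD by blast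
  then obtain i j where ij: "i < j" "foldl \<delta> q0 (p i) = foldl \<delta> q0 (p j)"
    unfolding inj_def by (metis linorder_neqE_nat)
  then have "foldl \<delta> q0 (p i @ s) = foldl \<delta> q0 (p j @ s)" for s
    by simp
  with distinguishing[OF ij(1)] show False
    unfolding L by (metis (no_types, lifting) mem_Collect_eq)
qed

lemma list_order_Nil [simp]: "list_order [] = {}"
  by (simp add: list_order_def)

text \<open>Replaces indices by recursion, so that the facts below go by induction and the order on
  a concrete alphabet is computed by \<open>simp\<close>.\<close>

lemma list_order_Cons [simp]: "list_order (x # xs) = {x} \<times> set xs \<union> list_order xs"
proof -
  have "(a, b) \<in> list_order (x # xs) \<longleftrightarrow> (a, b) \<in> {x} \<times> set xs \<union> list_order xs" for a b
  proof
    assume "(a, b) \<in> list_order (x # xs)"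
    then obtain i j where ij: "i < j" "j < length (x # xs)" "a = (x # xs) ! i" "b = (x # xs) ! j"
      unfolding list_order_def by blast
    then obtain j' where j': "j = Suc j'"
      by (cases j) auto
    show "(a, b) \<in> {x} \<times> set xs \<union> list_order xs"
    proof (cases i)
      case 0
      then show ?thesis using ij j' by simp
    next
      case (Suc i')
      then have "(a, b) \<in> list_order xs"
        using ij j' unfolding list_order_def by auto
      then show ?thesis by simp
    qed
  next
    assume "(a, b) \<in> {x} \<times> set xs \<union> list_order xs"
    then consider "a = x" "b \<in> set xs" | "(a, b) \<in> list_order xs" by auto
    then show "(a, b) \<in> list_order (x # xs)"
    proof cases
      case 1
      then obtain j where "j < length xs" "b = xs ! j"
        by (auto simp: in_set_conv_nth)
      with 1 have "0 < Suc j \<and> Suc j < length (x # xs) \<and> a = (x # xs) ! 0 \<and> b = (x # xs) ! Suc j"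
        by simp
      then show ?thesis unfolding list_order_def by blast
    next
      case 2
      then obtain i j where "i < j" "j < length xs" "a = xs ! i" "b = xs ! j"
        unfolding list_order_def by blast
      then have "Suc i < Suc j \<and> Suc j < length (x # xs) \<and> a = (x # xs) ! Suc i \<and> b = (x # xs) ! Suc j"
        by simp
      then show ?thesis unfolding list_order_def by blast
    qed
  qed
  then show ?thesis by auto
qed

lemma list_order_subset: "list_order xs \<subseteq> set xs \<times> set xs"
  by (induction xs) auto

lemma list_order_total:
  "x \<in> set xs \<Longrightarrow> y \<in> set xs \<Longrightarrow> x \<noteq> y \<Longrightarrow> (x, y) \<in> list_order xs \<or> (y, x) \<in> list_order xs"
  by (induction xs) auto

lemma list_order_map: "(x, y) \<in> list_order xs \<Longrightarrow> (f x, f y) \<in> list_order (map f xs)"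
  by (induction xs) auto

lemma trans_list_order: "distinct xs \<Longrightarrow> trans (list_order xs)"
proof (induction xs)
  case (Cons x xs)
  then show ?case
    using list_order_subset[of xs] by (auto simp: trans_def dest: subsetD)
qed simp

lemma asym_list_order: "distinct xs \<Longrightarrow> asym (list_order xs)"
proof (induction xs)
  case (Cons x xs)
  then show ?case
    using list_order_subset[of xs] by (auto simp: asym_iff)
qed (simp add: asym_iff)

lemma wf_list_order:
  assumes "distinct xs"
  shows "wf (list_order xs)"
proof (rule finite_acyclic_wf)
  show "finite (list_order xs)"
    by (rule finite_subset[OF list_order_subset]) simp
  show "acyclic (list_order xs)"
    using trans_list_order[OF assms] asym_list_order[OF assms]
    by (auto simp: acyclic_def dest: asymD)
qed

lemma lenlex_total_on:
  assumes "\<And>x y. x \<in> X \<Longrightarrow> y \<in> X \<Longrightarrow> x \<noteq> y \<Longrightarrow> (x, y) \<in> r \<or> (y, x) \<in> r"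
  shows "v \<in> lists X \<Longrightarrow> w \<in> lists X \<Longrightarrow> v \<noteq> w \<Longrightarrow> (v, w) \<in> lenlex r \<or> (w, v) \<in> lenlex r"
proof (induction v arbitrary: w)
  case (Cons x v)
  show ?case
  proof (cases w)
    case (Cons y w')
    then show ?thesis
      using Cons.prems Cons.IH[of w'] assms[of x y]
      by (auto simp: Cons_lenlex_iff) 
  qed simp
qed simp

lemma shortlex_least_eqI:
  assumes "asym r"
    and "w \<in> lists X" "word_value G w \<in> S"
    and "\<And>v. v \<in> lists X \<Longrightarrow> word_value G v \<in> S \<Longrightarrow> v \<noteq> w \<Longrightarrow> (w, v) \<in> lenlex r"
  shows "shortlex_least G X r S = w"
  unfolding shortlex_least_def
proof (rule the_equality)
  show "w \<in> lists X \<and> word_value G w \<in> S \<and>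
      (\<forall>v\<in>lists X. word_value G v \<in> S \<and> v \<noteq> w \<longrightarrow> (w, v) \<in> lenlex r)"
    using assms by blast
next
  fix w' assume w': "w' \<in> lists X \<and> word_value G w' \<in> S \<and>
      (\<forall>v\<in>lists X. word_value G v \<in> S \<and> v \<noteq> w' \<longrightarrow> (w', v) \<in> lenlex r)"
  show "w' = w"
  proof (rule ccontr)
    assume "w' \<noteq> w"
    then have "(w, w') \<in> lenlex r" "(w', w) \<in> lenlex r"
      using assms w' by auto
    then show False
      using asym_lenlex[OF \<open>asym r\<close>] by (auto dest: asymD)
  qed
qed

text \<open>A single word with value in \<open>S\<close> makes the definite description meaningful:
  \<open>lenlex\<close> of a finite strict order is well-founded, so a minimal word exists, and
  totality on \<open>lists (set xs)\<close> makes it the least one.\<close>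

lemma shortlex_least_properties:
  assumes "distinct xs" "v \<in> lists (set xs)" "word_value G v \<in> S"
  shows "shortlex_least G (set xs) (list_order xs) S \<in> lists (set xs)"
    and "word_value G (shortlex_least G (set xs) (list_order xs) S) \<in> S"
    and "length (shortlex_least G (set xs) (list_order xs) S) \<le> length v"
proof -
  let ?A = "{v \<in> lists (set xs). word_value G v \<in> S}"
  obtain w where w: "w \<in> ?A" "\<And>v. (v, w) \<in> lenlex (list_order xs) \<Longrightarrow> v \<notin> ?A"
    using wfE_min[OF wf_lenlex[OF wf_list_order[OF assms(1)]], of v ?A] assms by blast
  have least: "(w, v) \<in> lenlex (list_order xs)" if "v \<in> ?A" "v \<noteq> w" for v
    using that w lenlex_total_on[of "set xs" "list_order xs" v w] list_order_total[of _ xs] by blast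
  have eq: "shortlex_least G (set xs) (list_order xs) S = w"
    using w least by (intro shortlex_least_eqI asym_list_order assms) auto
  show "shortlex_least G (set xs) (list_order xs) S \<in> lists (set xs)"
    and "word_value G (shortlex_least G (set xs) (list_order xs) S) \<in> S"
    using w by (auto simp: eq)
  show "length (shortlex_least G (set xs) (list_order xs) S) \<le> length v"
    using least[of v] assms lenlex_length by (cases "v = w") (auto simp: eq)
qed

lemma word_length_le:
  assumes "w \<in> lists X"
  shows "word_length G X (word_value G w) \<le> length w"
  unfolding word_length_def using assms by (intro Least_le) blast

lemma word_length_eqI:
  assumes "w \<in> lists X" "word_value G w = g"
    and "\<And>v. v \<in> lists X \<Longrightarrow> word_value G v = g \<Longrightarrow> length w \<le> length v"
  shows "word_length G X g = length w"
  unfolding word_length_def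
  using assms by (intro Least_equality) auto

section \<open>A model of \<open>K\<close>\<close>

text \<open>
  The pair \<open>((x, y), (k, l))\<close> stands for \<open>a\<^sup>x b\<^sup>y (ut)\<^sup>k t\<^sup>l\<close> where \<open>b = tat\<close>; thus \<open>t\<close> is \<open>(0, 1)\<close>
  and \<open>u\<close> is \<open>(1, 1)\<close> in \<^term>\<open>dihedral_group 4\<close>.  Since \<open>u\<close> acts trivially and \<open>t\<close> swaps the
  coordinates, the action of \<open>(k, l)\<close> is read off the parity of the number of factors \<open>t\<close>, which
  is that of \<open>k + l\<close>.
\<close>

type_synonym K_model_elem = "(int \<times> int) \<times> (int \<times> int)"

definition D8_set :: "(int \<times> int) set" where
  "D8_set = {0..<4} \<times> {0..<2}"

definition K_action :: "int \<times> int \<Rightarrow> int \<times> int \<Rightarrow> int \<times> int" where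
  "K_action h v = (if even (fst h + snd h) then v else prod.swap v)"

definition K_model :: "K_model_elem monoid" where
  "K_model = semidirect_product (integer_group \<times>\<times> integer_group) K_action (dihedral_group 4)"

lemma carrier_dihedral_group_4 [simp]: "carrier (dihedral_group 4) = D8_set"
  by (simp add: dihedral_group_def semidirect_product_def D8_set_def carrier_integer_mod_group)

lemma carrier_K_model [simp]: "carrier K_model = UNIV \<times> D8_set"
  by (simp add: K_model_def semidirect_product_def)

lemma D8_cases:
  assumes "h \<in> D8_set"
  obtains "h = (0, 0)" | "h = (1, 0)" | "h = (2, 0)" | "h = (3, 0)"
    | "h = (0, 1)" | "h = (1, 1)" | "h = (2, 1)" | "h = (3, 1)"
proof -
  obtain k l where h: "h = (k, l)" by (cases h)
  then have "k \<in> {0..<4}" "l \<in> {0..<2}"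
    using assms by (auto simp: D8_set_def)
  then have "k = 0 \<or> k = 1 \<or> k = 2 \<or> k = 3" "l = 0 \<or> l = 1"
    by auto
  then show ?thesis using that h by auto
qed

text \<open>The right factor is required to lie in \<open>D8_set\<close> because the action in
  \<open>dihedral_group\<close> is a restricted function, unspecified outside the carrier.\<close>

lemma mult_dihedral_group_4:
  assumes "(k', l') \<in> D8_set"
  shows "(k, l) \<otimes>\<^bsub>dihedral_group 4\<^esub> (k', l')
    = ((if l = 0 then k + k' else k - k') mod 4, (l + l') mod 2)"
  using assms
  by (simp add: dihedral_group_def semidirect_product_def D8_set_def carrier_integer_mod_group
      mod_simps)

lemma mult_K_model:
  assumes "h' \<in> D8_set"
  shows "(v, h) \<otimes>\<^bsub>K_model\<^esub> (v', h')
    = ((fst v + fst (K_action h v'), snd v + snd (K_action h v')), h \<otimes>\<^bsub>dihedral_group 4\<^esub> h')"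
  by (cases v; cases "K_action h v'") (simp add: K_model_def semidirect_product_def)

lemma K_action_hom: "K_action \<in> hom (dihedral_group 4) (AutoGroup (integer_group \<times>\<times> integer_group))"
proof (rule homI)
  have bij: "K_action h \<in> Bij UNIV" for h
  proof -
    have "bij (K_action h)"
      by (rule involuntory_imp_bij) (simp add: K_action_def)
    then show ?thesis by (simp add: Bij_def)
  qed
  show "K_action h \<in> carrier (AutoGroup (integer_group \<times>\<times> integer_group))"
    for h
    using bij[of h] by (auto simp: AutoGroup_def auto_def hom_def K_action_def)
  fix h h' assume "h \<in> carrier (dihedral_group 4)" "h' \<in> carrier (dihedral_group 4)"
  then have "h \<in> D8_set" "h' \<in> D8_set" by simp_all
  \<comment> \<open>The parity of \<open>k + l\<close> is additive on the dihedral group, because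
    reduction modulo 4 and modulo 2 preserves parity.\<close>
  then have "K_action (h \<otimes>\<^bsub>dihedral_group 4\<^esub> h') v = K_action h (K_action h' v)" for v
    by (elim D8_cases) (simp_all add: mult_dihedral_group_4 D8_set_def K_action_def)
  then have "K_action (h \<otimes>\<^bsub>dihedral_group 4\<^esub> h') = compose UNIV (K_action h) (K_action h')"
    by (simp add: compose_def fun_eq_iff)
  then show "K_action (h \<otimes>\<^bsub>dihedral_group 4\<^esub> h')
      = K_action h \<otimes>\<^bsub>AutoGroup (integer_group \<times>\<times> integer_group)\<^esub> K_action h'"
    using bij by (simp add: AutoGroup_def BijGroup_def)
qed

section \<open>The isomorphism\<close>

text \<open>Left multiplication by a letter in the coordinates of the model. The last two equations
  are t(ut)^k = (ut)^(-k) t and u(ut)^k = (ut)^(1-k) t; they ignore \<open>e\<close> since t and u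
  are involutions.\<close>

fun letter_act :: "K_gen \<times> bool \<Rightarrow> K_model_elem \<Rightarrow> K_model_elem" where
  "letter_act (gen_a, e) ((x, y), h) = ((if e then x + 1 else x - 1, y), h)"
| "letter_act (gen_c, e) ((x, y), h) = ((if e then x + 2 else x - 2, y), h)"
| "letter_act (gen_d, e) ((x, y), h) = (if e then (x + 1, y + 1) else (x - 1, y - 1), h)"
| "letter_act (gen_t, e) ((x, y), (k, l)) = ((y, x), (- k mod 4, (l + 1) mod 2))"
| "letter_act (gen_u, e) ((x, y), (k, l)) = ((x, y), ((1 - k) mod 4, (l + 1) mod 2))"

abbreviation word_act :: "K_gen gword \<Rightarrow> K_model_elem \<Rightarrow> K_model_elem" where
  "word_act w \<equiv> foldr letter_act w"

abbreviation word_elem :: "K_gen gword \<Rightarrow> K_model_elem" where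
  "word_elem w \<equiv> word_act w ((0, 0), (0, 0))"

lemma letter_act_closed: "p \<in> carrier K_model \<Longrightarrow> letter_act s p \<in> carrier K_model"
  by (cases "(s, p)" rule: letter_act.cases) (auto simp: D8_set_def)

lemma word_act_closed: "p \<in> carrier K_model \<Longrightarrow> word_act w p \<in> carrier K_model"
  by (induction w) (auto intro: letter_act_closed simp del: carrier_K_model)

lemma word_elem_closed: "word_elem w \<in> carrier K_model"
  by (rule word_act_closed) (simp add: D8_set_def)

lemma letter_act_cancel:
  assumes "p \<in> carrier K_model"
  shows "letter_act (s, e) (letter_act (s, \<not> e) p) = p"
proof -
  obtain x y h where p: "p = ((x, y), h)" by (cases p) auto
  with assms have "h \<in> D8_set" by simp
  then show ?thesis
    by (elim D8_cases; cases s) (simp_all add: p)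
qed

lemma letter_act_inj:
  "letter_act s p = letter_act s q \<Longrightarrow> p \<in> carrier K_model \<Longrightarrow> q \<in> carrier K_model \<Longrightarrow> p = q"
  using letter_act_cancel[of p "fst s" "\<not> snd s"] letter_act_cancel[of q "fst s" "\<not> snd s"]
  by simp

lemma K_relations_word_act:
  assumes "(u, v) \<in> K_relations" "p \<in> carrier K_model"
  shows "word_act u p = word_act v p"
proof -
  obtain x y h where p: "p = ((x, y), h)" by (cases p) auto
  with assms have "h \<in> D8_set" by simp
  then show ?thesis
    using assms(1)
    by (elim D8_cases) (auto simp: p K_relations_def Let_def numeral_eq_Suc)
qed

text \<open>Von Dyck's argument: the letters act invertibly and the defining relations hold as
  transformations of the model, so the action of a word depends only on its class.\<close>

lemma pres_eq_word_act:
  "pres_eq K_relations u v \<Longrightarrow> p \<in> carrier K_model \<Longrightarrow> word_act u p = word_act v p"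
proof (induction arbitrary: p rule: pres_eq.induct)
  case (pres_cancel x e)
  then show ?case by (simp add: letter_act_cancel del: carrier_K_model)
qed (simp_all add: K_relations_word_act word_act_closed del: carrier_K_model)

text \<open>Associativity for the left factors t and u, the only letters that change the dihedral
  part.\<close>

lemma dihedral_group_4_step:
  assumes "(k, l) \<in> D8_set" "h \<in> D8_set"
    and "(k, l) \<otimes>\<^bsub>dihedral_group 4\<^esub> h = (m, n)"
  shows "(- k mod 4, (l + 1) mod 2) \<otimes>\<^bsub>dihedral_group 4\<^esub> h = (- m mod 4, (n + 1) mod 2)"
    and "((1 - k) mod 4, (l + 1) mod 2) \<otimes>\<^bsub>dihedral_group 4\<^esub> h = ((1 - m) mod 4, (n + 1) mod 2)"
proof -
  obtain k' l' where h: "h = (k', l')" by (cases h)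
  have l: "l = 0 \<or> l = 1" using assms(1) by (auto simp: D8_set_def)
  have mn: "m = (if l = 0 then k + k' else k - k') mod 4" "n = (l + l') mod 2"
    using assms(2,3) by (simp_all add: h mult_dihedral_group_4)
  show "(- k mod 4, (l + 1) mod 2) \<otimes>\<^bsub>dihedral_group 4\<^esub> h = (- m mod 4, (n + 1) mod 2)"
    and "((1 - k) mod 4, (l + 1) mod 2) \<otimes>\<^bsub>dihedral_group 4\<^esub> h = ((1 - m) mod 4, (n + 1) mod 2)"
    using l assms(2)
    by (auto simp: h mn mult_dihedral_group_4 mod_simps algebra_simps)
qed

text \<open>Left multiplications commute with right multiplications. Hence \<open>word_elem\<close>
  is multiplicative, and this is obtained without proving the group axioms for
  \<open>K_model\<close> first.\<close>

lemma letter_act_mult: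
  assumes "p \<in> carrier K_model" "q \<in> carrier K_model"
  shows "letter_act s (q \<otimes>\<^bsub>K_model\<^esub> p) = letter_act s q \<otimes>\<^bsub>K_model\<^esub> p"
proof -
  obtain x y h where p: "p = ((x, y), h)" by (cases p) auto
  obtain x' y' k l where q: "q = ((x', y'), (k, l))" by (metis prod.collapse)
  obtain m n where mn: "(k, l) \<otimes>\<^bsub>dihedral_group 4\<^esub> h = (m, n)"
    by (cases "(k, l) \<otimes>\<^bsub>dihedral_group 4\<^esub> h")
  obtain g e where s: "s = (g, e)" by (cases s)
  have h: "h \<in> D8_set" and kl: "(k, l) \<in> D8_set" using assms by (simp_all add: p q)
  \<comment> \<open>Together with \<open>l + 1\<close> these say that t flips the parity of
    \<open>k + l\<close>, on which the action depends, and that u preserves it.\<close>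
  have even_t: "even (- k mod 4) \<longleftrightarrow> even k" and even_u: "even ((1 - k) mod 4) \<longleftrightarrow> odd k"
    by presburger+
  show ?thesis
    by (cases g)
      (simp_all add: p q s mult_K_model[OF h] mn dihedral_group_4_step[OF kl h mn] K_action_def
        even_t even_u)
qed

lemma word_act_eq_mult:
  assumes "p \<in> carrier K_model"
  shows "word_act w p = word_elem w \<otimes>\<^bsub>K_model\<^esub> p"
proof (induction w)
  case Nil
  obtain x y k l where p: "p = ((x, y), (k, l))" by (metis prod.collapse)
  with assms have "(k, l) \<in> D8_set" by simp
  then show ?case
    by (simp add: p mult_K_model mult_dihedral_group_4 K_action_def) (simp add: D8_set_def)
next
  case (Cons s w)
  then show ?case
    using letter_act_mult[OF assms word_elem_closed] by simp
qed

lemma word_elem_append: "word_elem (u @ v) = word_elem u \<otimes>\<^bsub>K_model\<^esub> word_elem v"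
  by (simp add: word_act_eq_mult[OF word_elem_closed])

section \<open>Normal forms in the presented group\<close>

lemma group_K_group: "group K_group"
  unfolding K_group_def by (rule group_presented_group)

interpretation K: group K_group
  by (rule group_K_group)

abbreviation K_class :: "K_gen gword \<Rightarrow> K_gen gword set" where
  "K_class \<equiv> pres_class K_relations"

lemma carrier_K_group: "carrier K_group = range K_class"
  by (simp add: K_group_def)

lemma K_class_closed [simp]: "K_class w \<in> carrier K_group"
  by (simp add: carrier_K_group)

lemma K_class_mult: "K_class u \<otimes>\<^bsub>K_group\<^esub> K_class v = K_class (u @ v)"
  by (simp add: K_group_def)

lemma K_class_one: "\<one>\<^bsub>K_group\<^esub> = K_class []"
  by (simp add: K_group_def)

lemma K_class_inverse_letter: "inv\<^bsub>K_group\<^esub> K_class [(s, e)] = K_class [(s, \<not> e)]"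
  using pres_cancel[of K_relations s "\<not> e"]
  by (intro K.inv_equality) (simp_all add: K_class_mult K_class_one pres_class_eq_iff)

lemma K_class_eqI: "(u, v) \<in> K_relations \<Longrightarrow> K_class u = K_class v"
  by (simp add: pres_class_eq_iff pres_rel)

lemma (in group) intertwine_nat_pow:
  assumes "g \<otimes> x = y \<otimes> g" "g \<in> carrier G" "x \<in> carrier G" "y \<in> carrier G"
  shows "g \<otimes> x [^] (n::nat) = y [^] n \<otimes> g"
proof (induction n)
  case (Suc n)
  have "g \<otimes> x [^] Suc n = y [^] n \<otimes> (g \<otimes> x)"
    using assms(2-4) Suc.IH by (simp add: m_assoc[symmetric])
  also have "\<dots> = y [^] Suc n \<otimes> g"
    using assms by (simp add: m_assoc)
  finally show ?case .
qed (use assms in simp)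

text \<open>Conjugation written without inverses. It serves both for commuting elements and for
  moving t past powers of a, b and ut.\<close>

lemma (in group) intertwine_int_pow:
  assumes "g \<otimes> x = y \<otimes> g" "g \<in> carrier G" "x \<in> carrier G" "y \<in> carrier G"
  shows "g \<otimes> x [^] (n::int) = y [^] n \<otimes> g"
proof (cases n rule: int_cases2)
  case (nonneg m)
  then show ?thesis using intertwine_nat_pow[OF assms] by (simp add: int_pow_int)
next
  case (nonpos m)
  have "g \<otimes> x [^] m = y [^] m \<otimes> g" using intertwine_nat_pow[OF assms] .
  then have "inv (y [^] m) \<otimes> (g \<otimes> x [^] m) \<otimes> inv (x [^] m)
      = inv (y [^] m) \<otimes> (y [^] m \<otimes> g) \<otimes> inv (x [^] m)" by simp
  then have "inv (y [^] m) \<otimes> g = g \<otimes> inv (x [^] m)"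
    using assms by (simp add: m_assoc inv_solve_left')
  then show ?thesis using nonpos assms by (simp add: int_pow_neg int_pow_int)
qed

lemma (in group) int_pow_mod:
  assumes "x \<in> carrier G" "x [^] m = \<one>"
  shows "x [^] (k mod m :: int) = x [^] k"
proof -
  have "x [^] (m * (k div m) + k mod m) = (x [^] m) [^] (k div m) \<otimes> x [^] (k mod m)"
    using assms(1) by (simp only: int_pow_mult int_pow_pow)
  then show ?thesis using assms by simp
qed

abbreviation "gA \<equiv> K_elem gen_a"
abbreviation "gD \<equiv> K_elem gen_d"
abbreviation "gT \<equiv> K_elem gen_t"
abbreviation "gU \<equiv> K_elem gen_u"
definition "gB = gT \<otimes>\<^bsub>K_group\<^esub> gA \<otimes>\<^bsub>K_group\<^esub> gT"
definition "gR = gU \<otimes>\<^bsub>K_group\<^esub> gT"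

lemma K_elem_closed [simp]: "K_elem x \<in> carrier K_group"
  by (simp add: K_elem_def)

lemma gB_closed [simp]: "gB \<in> carrier K_group"
  and gR_closed [simp]: "gR \<in> carrier K_group"
  by (simp_all add: gB_def gR_def)

lemma K_group_relations:
  shows "gT \<otimes>\<^bsub>K_group\<^esub> gT = \<one>\<^bsub>K_group\<^esub>"
    and "gU \<otimes>\<^bsub>K_group\<^esub> gU = \<one>\<^bsub>K_group\<^esub>"
    and "(gT \<otimes>\<^bsub>K_group\<^esub> gU) [^]\<^bsub>K_group\<^esub> (4::nat) = \<one>\<^bsub>K_group\<^esub>"
    and "gA \<otimes>\<^bsub>K_group\<^esub> gD = gD \<otimes>\<^bsub>K_group\<^esub> gA"
    and "K_elem gen_c = gA \<otimes>\<^bsub>K_group\<^esub> gA"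
    and "gT \<otimes>\<^bsub>K_group\<^esub> gA \<otimes>\<^bsub>K_group\<^esub> gT = inv\<^bsub>K_group\<^esub> gA \<otimes>\<^bsub>K_group\<^esub> gD"
    and "gU \<otimes>\<^bsub>K_group\<^esub> gA \<otimes>\<^bsub>K_group\<^esub> gU = gA"
    and "gU \<otimes>\<^bsub>K_group\<^esub> gD \<otimes>\<^bsub>K_group\<^esub> gU = gD"
proof -
  have rels: "([(gen_t, True), (gen_t, True)], []) \<in> K_relations"
    "([(gen_u, True), (gen_u, True)], []) \<in> K_relations"
    "([(gen_t, True), (gen_u, True), (gen_t, True), (gen_u, True),
       (gen_t, True), (gen_u, True), (gen_t, True), (gen_u, True)], []) \<in> K_relations"
    "([(gen_a, True), (gen_d, True)], [(gen_d, True), (gen_a, True)]) \<in> K_relations"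
    "([(gen_c, True)], [(gen_a, True), (gen_a, True)]) \<in> K_relations"
    "([(gen_t, True), (gen_a, True), (gen_t, True)], [(gen_a, False), (gen_d, True)]) \<in> K_relations"
    "([(gen_u, True), (gen_a, True), (gen_u, True)], [(gen_a, True)]) \<in> K_relations"
    "([(gen_u, True), (gen_d, True), (gen_u, True)], [(gen_d, True)]) \<in> K_relations"
    by (simp_all add: K_relations_def Let_def numeral_eq_Suc)
  have pow4: "x [^]\<^bsub>K_group\<^esub> (4::nat) = x \<otimes>\<^bsub>K_group\<^esub> x \<otimes>\<^bsub>K_group\<^esub> x \<otimes>\<^bsub>K_group\<^esub> x"
    if "x \<in> carrier K_group" for x
    using that by (simp add: numeral_eq_Suc)
  note [simp] = K_elem_def K_class_mult K_class_one K_class_inverse_letter pow4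
  show "gT \<otimes>\<^bsub>K_group\<^esub> gT = \<one>\<^bsub>K_group\<^esub>"
    and "gU \<otimes>\<^bsub>K_group\<^esub> gU = \<one>\<^bsub>K_group\<^esub>"
    and "(gT \<otimes>\<^bsub>K_group\<^esub> gU) [^]\<^bsub>K_group\<^esub> (4::nat) = \<one>\<^bsub>K_group\<^esub>"
    and "gA \<otimes>\<^bsub>K_group\<^esub> gD = gD \<otimes>\<^bsub>K_group\<^esub> gA"
    and "K_elem gen_c = gA \<otimes>\<^bsub>K_group\<^esub> gA"
    and "gT \<otimes>\<^bsub>K_group\<^esub> gA \<otimes>\<^bsub>K_group\<^esub> gT = inv\<^bsub>K_group\<^esub> gA \<otimes>\<^bsub>K_group\<^esub> gD"
    and "gU \<otimes>\<^bsub>K_group\<^esub> gA \<otimes>\<^bsub>K_group\<^esub> gU = gA"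
    and "gU \<otimes>\<^bsub>K_group\<^esub> gD \<otimes>\<^bsub>K_group\<^esub> gU = gD"
    using rels[THEN K_class_eqI] by simp_all
qed

text \<open>The way back from coordinates to K. It yields that words with equal coordinates
  represent the same element.\<close>

definition K_normal_form :: "K_model_elem \<Rightarrow> K_gen gword set" where
  "K_normal_form p = gA [^]\<^bsub>K_group\<^esub> fst (fst p) \<otimes>\<^bsub>K_group\<^esub> gB [^]\<^bsub>K_group\<^esub> snd (fst p)
    \<otimes>\<^bsub>K_group\<^esub> gR [^]\<^bsub>K_group\<^esub> fst (snd p) \<otimes>\<^bsub>K_group\<^esub> gT [^]\<^bsub>K_group\<^esub> snd (snd p)"

context
begin

private abbreviation K_mult (infixl "\<odot>" 70) where "x \<odot> y \<equiv> x \<otimes>\<^bsub>K_group\<^esub> y"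

lemma gT_gA: "gT \<odot> gA = gB \<odot> gT"
  by (simp add: gB_def K.m_assoc K_group_relations(1))

lemma gT_gB: "gT \<odot> gB = gA \<odot> gT"
  by (simp add: gB_def K.m_assoc[symmetric] K_group_relations(1))

lemma gD_eq: "gD = gA \<odot> gB"
  by (simp add: gB_def K_group_relations(6) K.m_assoc[symmetric])

lemma gA_gB: "gA \<odot> gB = gB \<odot> gA"
proof -
  have "gB = inv\<^bsub>K_group\<^esub> gA \<odot> gD"
    by (simp add: gB_def K_group_relations(6))
  then have "gB \<odot> gA = inv\<^bsub>K_group\<^esub> gA \<odot> gD \<odot> gA"
    by (rule arg_cong)
  also have "\<dots> = inv\<^bsub>K_group\<^esub> gA \<odot> (gA \<odot> gD)"
    by (simp add: K.m_assoc K_group_relations(4))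
  also have "\<dots> = gA \<odot> gB"
    by (simp add: K.m_assoc[symmetric] gD_eq)
  finally show ?thesis ..
qed

lemma gU_gA: "gU \<odot> gA = gA \<odot> gU"
proof -
  have "gU \<odot> gA = gU \<odot> gA \<odot> gU \<odot> gU"
    by (simp add: K.m_assoc K_group_relations(2))
  then show ?thesis by (simp only: K_group_relations(7))
qed

lemma gU_gD: "gU \<odot> gD = gD \<odot> gU"
proof -
  have "gU \<odot> gD = gU \<odot> gD \<odot> gU \<odot> gU"
    by (simp add: K.m_assoc K_group_relations(2))
  then show ?thesis by (simp only: K_group_relations(8))
qed

lemma gU_gB: "gU \<odot> gB = gB \<odot> gU"
proof -
  \<comment> \<open>Since u commutes with d = ab and with a, the factor a can be cancelled on the
    left.\<close>
  have "gA \<odot> (gU \<odot> gB) = gA \<odot> (gB \<odot> gU)"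
    using gU_gD gU_gA by (simp add: gD_eq K.m_assoc[symmetric])
  then show ?thesis by simp
qed

lemma gR_gT: "gR \<odot> gT = gU"
  by (simp add: gR_def K.m_assoc K_group_relations(1))

lemma inv_gR: "inv\<^bsub>K_group\<^esub> gR = gT \<odot> gU"
  by (rule K.inv_equality)
    (simp_all add: gR_def K.m_assoc[symmetric] K_group_relations(1,2),
     simp add: K.m_assoc K_group_relations(1,2))

lemma gT_gR: "gT \<odot> gR = inv\<^bsub>K_group\<^esub> gR \<odot> gT"
  unfolding inv_gR by (simp add: gR_def K.m_assoc)

lemma gR_pow_4: "gR [^]\<^bsub>K_group\<^esub> (4::int) = \<one>\<^bsub>K_group\<^esub>"
proof -
  \<comment> \<open>The relation speaks of tu, the inverse of ut.\<close>
  have "inv\<^bsub>K_group\<^esub> (gR [^]\<^bsub>K_group\<^esub> (4::nat)) = \<one>\<^bsub>K_group\<^esub>"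
    using K_group_relations(3) by (simp add: inv_gR K.nat_pow_inv[symmetric])
  then have "gR [^]\<^bsub>K_group\<^esub> (4::nat) = \<one>\<^bsub>K_group\<^esub>"
    by (simp add: K.inv_eq_1_iff)
  then show ?thesis using int_pow_int[of K_group gR 4] by simp
qed

lemma gT_gR_pow: "gT \<odot> gR [^]\<^bsub>K_group\<^esub> (k::int) = gR [^]\<^bsub>K_group\<^esub> (- k) \<odot> gT"
  using K.intertwine_int_pow[OF gT_gR, of k] by (simp add: K.int_pow_inv K.int_pow_neg)

lemma gT_gT_pow:
  assumes "l \<in> {0..<2}"
  shows "gT \<odot> gT [^]\<^bsub>K_group\<^esub> l = gT [^]\<^bsub>K_group\<^esub> ((l + 1) mod 2 :: int)"
proof -
  have "l = 0 \<or> l = 1" using assms by auto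
  then show ?thesis by (auto simp: K_group_relations(1))
qed

lemma K_normal_form_closed: "K_normal_form p \<in> carrier K_group"
  by (simp add: K_normal_form_def)

text \<open>The translation part a^x b^y and the dihedral part are treated separately: a, c and d
  are absorbed by the former, whereas t and u pass through it, t exchanging the exponents, and are
  absorbed by the latter.\<close>

lemma K_elem_mult_normal_form:
  assumes "p \<in> carrier K_model"
  shows "K_elem s \<odot> K_normal_form p = K_normal_form (letter_act (s, True) p)"
proof -
  obtain x y k l where p: "p = ((x, y), (k, l))" by (metis prod.collapse)
  have l: "l \<in> {0..<2}" using assms by (auto simp: p D8_set_def)
  let ?V = "\<lambda>x y. gA [^]\<^bsub>K_group\<^esub> (x::int) \<odot> gB [^]\<^bsub>K_group\<^esub> (y::int)"
  let ?H = "\<lambda>k l. gR [^]\<^bsub>K_group\<^esub> (k::int) \<odot> gT [^]\<^bsub>K_group\<^esub> (l::int)"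
  have nf: "K_normal_form ((x, y), (k, l)) = ?V x y \<odot> ?H k l" for x y k l
    by (simp add: K_normal_form_def K.m_assoc)
  have commAB: "gA [^]\<^bsub>K_group\<^esub> i \<odot> gB [^]\<^bsub>K_group\<^esub> j = gB [^]\<^bsub>K_group\<^esub> j \<odot> gA [^]\<^bsub>K_group\<^esub> i" for i j :: int
    using K.intertwine_int_pow[OF K.intertwine_int_pow[OF gA_gB[symmetric], symmetric], of i j] by simp
  have mod4: "gR [^]\<^bsub>K_group\<^esub> (i mod 4) = gR [^]\<^bsub>K_group\<^esub> i" for i :: int
    by (rule K.int_pow_mod) (simp_all add: gR_pow_4)
  have A: "gA \<odot> ?V x y = ?V (x + 1) y" for x y
    by (simp add: K.int_pow_mult[symmetric] K.m_assoc[symmetric] add.commute[of x] K.int_pow_mult)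
  have B: "gB \<odot> ?V x y = ?V x (y + 1)" for x y
  proof -
    have "gB \<odot> ?V x y = (gB \<odot> gA [^]\<^bsub>K_group\<^esub> x) \<odot> gB [^]\<^bsub>K_group\<^esub> y"
      by (simp add: K.m_assoc)
    also have "\<dots> = gA [^]\<^bsub>K_group\<^esub> x \<odot> (gB \<odot> gB [^]\<^bsub>K_group\<^esub> y)"
      by (simp add: K.intertwine_int_pow[OF gA_gB[symmetric]] K.m_assoc)
    also have "gB \<odot> gB [^]\<^bsub>K_group\<^esub> y = gB [^]\<^bsub>K_group\<^esub> (y + 1)"
      using K.int_pow_mult[of gB 1 y] by (simp add: add.commute)
    finally show ?thesis .
  qed
  have T: "gT \<odot> ?V x y = ?V y x \<odot> gT"
  proof -
    have "gT \<odot> ?V x y = (gT \<odot> gA [^]\<^bsub>K_group\<^esub> x) \<odot> gB [^]\<^bsub>K_group\<^esub> y"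
      by (simp add: K.m_assoc)
    also have "\<dots> = gB [^]\<^bsub>K_group\<^esub> x \<odot> (gT \<odot> gB [^]\<^bsub>K_group\<^esub> y)"
      by (simp add: K.intertwine_int_pow[OF gT_gA] K.m_assoc)
    also have "\<dots> = gB [^]\<^bsub>K_group\<^esub> x \<odot> gA [^]\<^bsub>K_group\<^esub> y \<odot> gT"
      by (simp add: K.intertwine_int_pow[OF gT_gB] K.m_assoc)
    finally show ?thesis by (simp add: commAB)
  qed
  have U: "gU \<odot> ?V x y = ?V x y \<odot> gU"
  proof -
    have "gU \<odot> ?V x y = (gU \<odot> gA [^]\<^bsub>K_group\<^esub> x) \<odot> gB [^]\<^bsub>K_group\<^esub> y"
      by (simp add: K.m_assoc)
    also have "\<dots> = gA [^]\<^bsub>K_group\<^esub> x \<odot> (gU \<odot> gB [^]\<^bsub>K_group\<^esub> y)"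
      by (simp add: K.intertwine_int_pow[OF gU_gA] K.m_assoc)
    also have "\<dots> = ?V x y \<odot> gU"
      by (simp add: K.intertwine_int_pow[OF gU_gB] K.m_assoc)
    finally show ?thesis .
  qed
  have TH: "gT \<odot> ?H k l = ?H (- k mod 4) ((l + 1) mod 2)"
  proof -
    have "gT \<odot> ?H k l = (gT \<odot> gR [^]\<^bsub>K_group\<^esub> k) \<odot> gT [^]\<^bsub>K_group\<^esub> l"
      by (simp add: K.m_assoc)
    also have "\<dots> = gR [^]\<^bsub>K_group\<^esub> (- k) \<odot> (gT \<odot> gT [^]\<^bsub>K_group\<^esub> l)"
      by (simp add: gT_gR_pow K.m_assoc)
    finally show ?thesis by (simp add: gT_gT_pow[OF l] mod4)
  qed
  have UH: "gU \<odot> ?H k l = ?H ((1 - k) mod 4) ((l + 1) mod 2)"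
  proof -
    have "gU \<odot> ?H k l = gR \<odot> (gT \<odot> ?H k l)"
      by (simp add: gR_gT[symmetric] K.m_assoc)
    also have "\<dots> = gR \<odot> gR [^]\<^bsub>K_group\<^esub> (- k) \<odot> gT [^]\<^bsub>K_group\<^esub> ((l + 1) mod 2)"
      by (simp add: TH K.m_assoc mod4)
    also have "gR \<odot> gR [^]\<^bsub>K_group\<^esub> (- k) = gR [^]\<^bsub>K_group\<^esub> (1 - k)"
      using K.int_pow_mult[of gR 1 "- k"] by simp
    finally show ?thesis by (simp add: mod4)
  qed
  have closed: "?V x y \<in> carrier K_group" "?H k l \<in> carrier K_group" for x y k l
    by simp_all
  \<comment> \<open>\<open>via\<close> serves the letters a, c, d and \<open>via'\<close> the
    letters t, u.\<close>
  have via: "K_elem s \<odot> (?V x y \<odot> ?H k l) = ?V x' y' \<odot> ?H k l"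
    if "K_elem s \<odot> ?V x y = ?V x' y'" for s x' y'
    using that closed by (simp add: K.m_assoc[symmetric] del: K.int_pow_closed)
  have via': "K_elem s \<odot> (?V x y \<odot> ?H k l) = ?V x' y' \<odot> (K_elem s \<odot> ?H k l)"
    if "K_elem s \<odot> ?V x y = ?V x' y' \<odot> K_elem s" for s x' y'
    using that closed by (metis K.m_assoc K_elem_closed)
  show ?thesis
  proof (cases s)
    case gen_a
    show ?thesis using via[OF A] by (simp add: gen_a p nf)
  next
    case gen_c
    have "gA \<odot> gA \<odot> ?V x y = ?V (x + 2) y"
      using A[of x y] A[of "x + 1" y] closed
      by (simp add: K.m_assoc add.commute[of x 2] del: K.int_pow_closed)
    then show ?thesis
      using via[of gen_c] by (simp add: gen_c p nf K_group_relations(5))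
  next
    case gen_d
    have "gA \<odot> gB \<odot> ?V x y = ?V (x + 1) (y + 1)"
      using A[of x "y + 1"] B[of x y] closed by (simp add: K.m_assoc del: K.int_pow_closed)
    then show ?thesis
      using via[of gen_d] by (simp add: gen_d p nf gD_eq)
  next
    case gen_t
    show ?thesis using via'[OF T] TH by (simp add: gen_t p nf)
  next
    case gen_u
    show ?thesis using via'[OF U] UH by (simp add: gen_u p nf)
  qed
qed

lemma letter_mult_normal_form:
  assumes "p \<in> carrier K_model"
  shows "K_class [s] \<odot> K_normal_form p = K_normal_form (letter_act s p)"
proof (cases s)
  case (Pair g e)
  show ?thesis
  proof (cases e)
    case True
    then show ?thesis
      using K_elem_mult_normal_form[OF assms, of g] by (simp add: Pair K_elem_def)
  next
    case False
    \<comment> \<open>An inverse letter reduces to the positive one, applied at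
      \<open>letter_act (g, False) p\<close>.\<close>
    have "K_class [(g, True)] \<odot> K_normal_form (letter_act (g, False) p) = K_normal_form p"
      using K_elem_mult_normal_form[OF letter_act_closed[OF assms], of g "(g, False)"]
        letter_act_cancel[OF assms, of g True]
      by (simp add: K_elem_def)
    then show ?thesis
      using K_class_inverse_letter[of g True] False Pair
        K.inv_solve_left'[of "K_normal_form (letter_act (g, False) p)" "K_class [(g, True)]" "K_normal_form p"]
      by (simp add: K_normal_form_closed)
  qed
qed

end

section \<open>Coordinates on K and the word problem\<close>

lemma K_normal_form_word_elem: "K_normal_form (word_elem w) = K_class w"
proof (induction w)
  case Nil
  show ?case by (simp add: K_normal_form_def K_class_one)
next
  case (Cons s w)
  have "K_normal_form (word_elem (s # w)) = K_class [s] \<otimes>\<^bsub>K_group\<^esub> K_class w"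
    using letter_mult_normal_form[OF word_elem_closed, of s w] Cons.IH by simp
  then show ?case by (simp add: K_class_mult)
qed

text \<open>This solves the word problem: the action on the model separates elements, and the normal
  form recovers an element from its coordinates.\<close>

lemma K_class_eq_iff: "K_class v = K_class w \<longleftrightarrow> word_elem v = word_elem w"
proof
  assume "K_class v = K_class w"
  then have "pres_eq K_relations v w" by (simp add: pres_class_eq_iff)
  then show "word_elem v = word_elem w"
    by (rule pres_eq_word_act) (simp add: D8_set_def)
next
  assume "word_elem v = word_elem w"
  then show "K_class v = K_class w"
    using K_normal_form_word_elem by metis
qed

definition K_coord :: "K_gen gword set \<Rightarrow> K_model_elem" where
  "K_coord g = word_elem (SOME w. w \<in> g)"

lemma K_coord_class [simp]: "K_coord (K_class w) = word_elem w"
proof -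
  have "(SOME v. v \<in> K_class w) \<in> K_class w"
    by (rule someI[of _ w]) (simp add: pres_class_def pres_refl)
  then have "K_class w = K_class (SOME v. v \<in> K_class w)"
    by (simp add: pres_class_eq_iff) (simp add: pres_class_def)
  then show ?thesis by (simp add: K_coord_def K_class_eq_iff)
qed

text \<open>Formal letters in the order of \<open>K_letters\<close>. Length and order arguments are
  carried out on formal words and transported to K by \<open>K_word\<close>.\<close>

definition K_alphabet :: "(K_gen \<times> bool) list" where
  "K_alphabet = [(gen_a, True), (gen_c, True), (gen_a, False), (gen_c, False),
     (gen_d, True), (gen_d, False), (gen_t, True), (gen_u, True)]"

abbreviation K_word :: "K_gen gword \<Rightarrow> K_gen gword set list" where
  "K_word \<equiv> map (\<lambda>s. K_class [s])"

lemma K_letters_eq: "K_letters = K_word K_alphabet"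
  by (simp add: K_letters_def K_alphabet_def K_elem_def K_class_inverse_letter)

lemma lists_K_genset: "lists K_genset = K_word ` lists (set K_alphabet)"
  by (simp add: K_genset_def K_letters_eq lists_image)

lemma word_value_K_word: "word_value K_group (K_word w) = K_class w"
  by (induction w) (simp_all add: word_value_def K_class_one K_class_mult)

lemma K_class_letter_inj:
  "s \<in> set K_alphabet \<Longrightarrow> s' \<in> set K_alphabet \<Longrightarrow> K_class [s] = K_class [s'] \<Longrightarrow> s = s'"
  by (auto simp: K_alphabet_def K_class_eq_iff)

lemma distinct_K_letters: "distinct K_letters"
  unfolding K_letters_eq distinct_map
  using K_class_letter_inj by (auto simp: inj_on_def) (simp add: K_alphabet_def)

lemma letter_act_funpow:
  "(letter_act (gen_a, e) ^^ n) ((x, y), h) = ((if e then x + int n else x - int n, y), h)"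
  "(letter_act (gen_c, e) ^^ n) ((x, y), h) = ((if e then x + 2 * int n else x - 2 * int n, y), h)"
  "(letter_act (gen_d, e) ^^ n) ((x, y), h)
    = (if e then (x + int n, y + int n) else (x - int n, y - int n), h)"
  by (induction n) auto

lemma word_elem_surj:
  assumes "p \<in> carrier K_model"
  obtains w where "w \<in> lists (set K_alphabet)" "word_elem w = p"
proof -
  obtain x y h where p: "p = ((x, y), h)" by (cases p) auto
  let ?t = "(gen_t, True)" and ?u = "(gen_u, True)"
  have "h \<in> D8_set" using assms by (simp add: p)
  \<comment> \<open>One word over t and u for each of the eight elements of the dihedral
    group.\<close>
  then have "\<exists>r\<in>set [[], [?u, ?t], [?u, ?t, ?u, ?t], [?t, ?u], [?t], [?u], [?u, ?t, ?u], [?t, ?u, ?t]].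
      word_elem r = ((0, 0), h)"
    by (elim D8_cases) simp_all
  then obtain r where r: "set r \<subseteq> {?t, ?u}" "word_elem r = ((0, 0), h)"
    by force
  let ?a = "\<lambda>i::int. replicate (nat \<bar>i\<bar>) (gen_a, i \<ge> 0)"
  \<comment> \<open>The middle part is t a^y t = b^y.\<close>
  let ?w = "?a x @ [?t] @ ?a y @ [?t] @ r"
  obtain k l where h: "h = (k, l)" by (cases h)
  have "letter_act ?t (letter_act ?t ((x', y'), h)) = ((x', y'), h)" for x' y'
    using letter_act_cancel[of "((x', y'), h)" gen_t True] \<open>h \<in> D8_set\<close> by (simp add: h)
  then have "word_elem ?w = p"
    using r by (auto simp: p h letter_act_funpow)
  moreover have "?w \<in> lists (set K_alphabet)"
    using r by (auto simp: K_alphabet_def)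
  ultimately show ?thesis using that by blast
qed

lemma K_coord_iso: "K_coord \<in> iso K_group K_model"
proof (rule isoI)
  show "K_coord \<in> hom K_group K_model"
    using word_elem_closed
    by (auto intro!: homI simp: carrier_K_group K_class_mult word_elem_append
        simp del: carrier_K_model foldr_append)
  show "bij_betw K_coord (carrier K_group) (carrier K_model)"
    unfolding bij_betw_def
  proof
    show "inj_on K_coord (carrier K_group)"
      by (auto simp: inj_on_def carrier_K_group K_class_eq_iff)
    show "K_coord ` carrier K_group = carrier K_model"
    proof
      show "K_coord ` carrier K_group \<subseteq> carrier K_model"
        using word_elem_closed by (auto simp: carrier_K_group simp del: carrier_K_model)
      show "carrier K_model \<subseteq> K_coord ` carrier K_group"
      proof
        fix p assume "p \<in> carrier K_model"
        then obtain w where "word_elem w = p" using word_elem_surj by blast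
        then show "p \<in> K_coord ` carrier K_group"
          by (intro image_eqI[of _ _ "K_class w"]) simp_all
      qed
    qed
  qed
qed

lemma K_group_represented:
  assumes "g \<in> carrier K_group"
  obtains w where "w \<in> lists (set K_alphabet)" "g = K_class w"
proof -
  obtain v where v: "g = K_class v" using assms by (auto simp: carrier_K_group)
  obtain w where "w \<in> lists (set K_alphabet)" "word_elem w = word_elem v"
    using word_elem_surj[OF word_elem_closed] by metis
  then show ?thesis using that v K_class_eq_iff by metis
qed

lemma generate_K_genset: "generate K_group K_genset = carrier K_group"
proof
  have "K_genset \<subseteq> carrier K_group"
    by (auto simp: K_genset_def K_letters_eq)
  then show "generate K_group K_genset \<subseteq> carrier K_group"
    by (rule K.generate_incl)
  have "K_class w \<in> generate K_group K_genset" if "w \<in> lists (set K_alphabet)" for w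
    using that
  proof (induction w)
    case Nil
    show ?case using generate.one[of K_group] by (simp add: K_class_one)
  next
    case (Cons s w)
    then have "K_class [s] \<in> K_genset"
      by (auto simp: K_genset_def K_letters_eq)
    then show ?case
      using Cons.IH generate.eng[OF generate.incl, of "K_class [s]" K_genset "K_class w" K_group]
      by (simp add: K_class_mult)
  qed
  then show "carrier K_group \<subseteq> generate K_group K_genset"
    by (metis K_group_represented subsetI)
qed

section \<open>Length bounds and shortlex least words\<close>

text \<open>
  The length of a shortest word over \<open>t\<close>, \<open>u\<close> that contains \<open>t\<close> and represents \<open>h\<close>.
\<close>

definition t_cost :: "int \<times> int \<Rightarrow> int" where
  "t_cost h = (if h = (0, 1) then 1 else if h \<in> {(0, 0), (1, 0), (3, 0)} then 2
    else if h = (2, 0) then 4 else 3)"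

text \<open>
  A word without \<open>t\<close> represents an element with \<open>h = (0, 0)\<close> or \<open>h = (1, 1)\<close> and needs \<open>\<bar>y\<bar>\<close> letters
  \<open>d\<close> or \<open>d\<inverse>\<close> to produce the second coordinate, whereas a word containing \<open>t\<close> can use \<open>c\<close> and
  \<open>c\<inverse>\<close> in both coordinates, so that each letter contributes at most 2 to \<open>\<bar>x\<bar> + \<bar>y\<bar>\<close>.
\<close>

fun length_bound :: "K_model_elem \<Rightarrow> int \<Rightarrow> bool" where
  "length_bound ((x, y), h) n \<longleftrightarrow>
    h = (0, 0) \<and> 2 * \<bar>y\<bar> + \<bar>x - y\<bar> \<le> 2 * n \<or>
    h = (1, 1) \<and> 2 * \<bar>y\<bar> + \<bar>x - y\<bar> + 2 \<le> 2 * n \<or>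
    \<bar>x\<bar> + \<bar>y\<bar> + 2 * t_cost h \<le> 2 * n"

text \<open>Each letter a, c, d raises |x| + |y| and 2|y| + |x-y| by at most 2, matching the growth
  of 2n. Prepending t or u to a word that contains t raises \<open>t_cost\<close> by at most
  1.\<close>

lemma length_bound_step:
  assumes "p \<in> carrier K_model" "length_bound p n"
  shows "length_bound (letter_act s p) (n + 1)"
proof -
  obtain x y h where p: "p = ((x, y), h)" by (cases p) auto
  obtain g e where s: "s = (g, e)" by (cases s)
  have "h \<in> D8_set" using assms by (simp add: p)
  show ?thesis
  proof (cases "g = gen_t \<or> g = gen_u")
    case False
    have abs_step: "\<bar>z + 1\<bar> \<le> \<bar>z\<bar> + 1" "\<bar>z - 1\<bar> \<le> \<bar>z\<bar> + 1" "\<bar>z + 2\<bar> \<le> \<bar>z\<bar> + 2"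
      "\<bar>z - 2\<bar> \<le> \<bar>z\<bar> + 2" for z :: int
      by arith+
    obtain x' y' where xy: "letter_act s p = ((x', y'), h)" "\<bar>x'\<bar> + \<bar>y'\<bar> \<le> \<bar>x\<bar> + \<bar>y\<bar> + 2"
      "2 * \<bar>y'\<bar> + \<bar>x' - y'\<bar> \<le> 2 * \<bar>y\<bar> + \<bar>x - y\<bar> + 2"
    proof (cases g)
      case gen_a
      show ?thesis
        using that[of "if e then x + 1 else x - 1" y] abs_step[of x] abs_step[of "x - y"]
        by (cases e) (simp_all add: p s gen_a algebra_simps)
    next
      case gen_c
      show ?thesis
        using that[of "if e then x + 2 else x - 2" y] abs_step[of x] abs_step[of "x - y"]
        by (cases e) (simp_all add: p s gen_c algebra_simps)
    next
      case gen_d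
      show ?thesis
        using that[of "if e then x + 1 else x - 1" "if e then y + 1 else y - 1"]
          abs_step(1,2)[of x] abs_step(1,2)[of y]
        by (cases e) (simp_all add: p s gen_d)
    qed (use False in simp_all)
    have "P \<and> b \<le> 2 * n \<or> Q \<and> b + 2 \<le> 2 * n \<or> a + c \<le> 2 * n \<Longrightarrow> a' \<le> a + 2 \<Longrightarrow> b' \<le> b + 2 \<Longrightarrow>
      P \<and> b' \<le> 2 * (n + 1) \<or> Q \<and> b' + 2 \<le> 2 * (n + 1) \<or> a' + c \<le> 2 * (n + 1)"
      for P Q and a b c a' b' :: int
      by auto
    from this[OF assms(2)[unfolded p length_bound.simps] xy(2,3)] show ?thesis
      unfolding xy(1) length_bound.simps .
  next
    case True
    define a b where ab: "a = \<bar>x\<bar> + \<bar>y\<bar>" "b = 2 * \<bar>y\<bar> + \<bar>x - y\<bar>"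
    \<comment> \<open>This covers prepending the first t: a bound of the kind for words without t
      turns into one of the kind for words with t.\<close>
    have "a \<le> b" unfolding ab by arith
    have swap: "\<bar>y\<bar> + \<bar>x\<bar> = a" by (simp add: ab)
    note bounds = length_bound.simps[of x y, folded ab] length_bound.simps[of y x, unfolded swap]
    show ?thesis
      using True assms(2) \<open>h \<in> D8_set\<close> \<open>a \<le> b\<close>
      by (elim D8_cases disjE) (auto simp: p s t_cost_def bounds simp del: length_bound.simps)
  qed
qed

lemma length_bound: "length_bound (word_elem w) (int (length w))"
proof (induction w)
  case Nil
  show ?case by simp
next
  case (Cons s w)
  then show ?case
    using length_bound_step[OF word_elem_closed, of w "int (length w)" s] by (simp add: add.commute)
qed

text \<open>Only words of equal length compete, so that such words can be built up letter by letter
  from the right; minimality of the length is derived separately from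
  \<open>length_bound\<close>.\<close>

definition lex_least :: "K_gen gword \<Rightarrow> bool" where
  "lex_least w \<longleftrightarrow> w \<in> lists (set K_alphabet) \<and>
    (\<forall>v\<in>lists (set K_alphabet). length v = length w \<longrightarrow> word_elem v = word_elem w \<longrightarrow> v \<noteq> w \<longrightarrow>
      (w, v) \<in> lenlex (list_order K_alphabet))"

lemma lex_least_Nil: "lex_least []"
  by (simp add: lex_least_def)

text \<open>If a smaller first letter could be completed, then the bound would hold for the rest.\<close>

lemma lex_least_Cons:
  assumes "lex_least w" "s \<in> set K_alphabet"
    and smaller: "\<And>g e. ((g, e), s) \<in> list_order K_alphabet \<Longrightarrow>
      \<not> length_bound (letter_act (g, \<not> e) (word_elem (s # w))) (int (length w))"
  shows "lex_least (s # w)"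
  unfolding lex_least_def
proof (intro conjI ballI impI)
  show "s # w \<in> lists (set K_alphabet)" using assms by (simp add: lex_least_def)
  fix v assume v: "v \<in> lists (set K_alphabet)" "length v = length (s # w)"
    "word_elem v = word_elem (s # w)" "v \<noteq> s # w"
  then obtain s' v' where v': "v = s' # v'" by (cases v) auto
  obtain g e where s': "s' = (g, e)" by (cases s')
  show "(s # w, v) \<in> lenlex (list_order K_alphabet)"
  proof (cases "s' = s")
    case True
    then have "word_elem v' = word_elem w"
      using v letter_act_inj[OF _ word_elem_closed word_elem_closed, of s v' w] by (simp add: v')
    then show ?thesis
      using v assms(1) True by (simp add: v' lex_least_def Cons_lenlex_iff)
  next
    case False
    have "letter_act (g, \<not> e) (word_elem (s # w)) = word_elem v'"
      using v letter_act_cancel[OF word_elem_closed, of g "\<not> e" v'] by (simp add: v' s')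
    then have "length_bound (letter_act (g, \<not> e) (word_elem (s # w))) (int (length w))"
      using length_bound[of v'] v by (simp add: v')
    then have "(s', s) \<notin> list_order K_alphabet"
      using smaller[of g e] by (auto simp: s')
    then have "(s, s') \<in> list_order K_alphabet"
      using list_order_total[OF assms(2), of s'] False v by (auto simp: v')
    then show ?thesis
      using v by (simp add: v' Cons_lenlex_iff)
  qed
qed

lemma less_gen_c: "(s, (gen_c, True)) \<in> list_order K_alphabet \<longleftrightarrow> s = (gen_a, True)"
  by (simp add: K_alphabet_def)

abbreviation (input) "c_power n \<equiv> replicate n (gen_c, True)"

definition long_word :: "nat \<Rightarrow> nat \<Rightarrow> K_gen gword" where
  "long_word n m = c_power n @ [(gen_t, True)] @ c_power m @ [(gen_t, True), (gen_u, True)]"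

text \<open>This represents a conjugate by \<open>t\<close> of the element that \<^term>\<open>long_word n m\<close> represents.\<close>

definition conj_word :: "nat \<Rightarrow> nat \<Rightarrow> K_gen gword" where
  "conj_word m n = c_power m @ [(gen_t, True)] @ c_power n @ [(gen_u, True), (gen_t, True)]"

lemma word_elem_long_word: "word_elem (long_word n m) = ((2 * int n, 2 * int m), (1, 1))"
  by (simp add: long_word_def letter_act_funpow)

lemma word_elem_conj_word: "word_elem (conj_word m n) = ((2 * int m, 2 * int n), (3, 1))"
  by (simp add: conj_word_def letter_act_funpow)

text \<open>Only a precedes c, so it suffices that \<open>length_bound\<close> fails after a leading
  a is undone. The first clause fails by \<open>h\<close>, the third by the condition on
  \<open>x\<close> (each c raises both sides by 2, so \<open>n\<close> cancels), and the second by
  the last hypothesis, via |x-y| >= |y| - |x|.\<close>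

lemma lex_least_c_power:
  assumes "lex_least w" "word_elem w = ((x, y), h)" "h \<noteq> (0, 0)"
    and "n > 0 \<Longrightarrow> x \<ge> 0 \<and> x + \<bar>y\<bar> + 2 * t_cost h > 2 * int (length w) - 1"
    and "h = (1, 1) \<Longrightarrow> 3 * \<bar>y\<bar> \<ge> 4 * int n + x + 2 * int (length w)"
  shows "lex_least (c_power n @ w)"
  using assms(4,5)
proof (induction n)
  case 0
  show ?case using assms by simp
next
  case (Suc n)
  have "lex_least (c_power n @ w)"
  proof (rule Suc.IH)
    show "0 \<le> x \<and> 2 * int (length w) - 1 < x + \<bar>y\<bar> + 2 * t_cost h"
      using Suc.prems(1) by simp
    show "4 * int n + x + 2 * int (length w) \<le> 3 * \<bar>y\<bar>" if "h = (1, 1)"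
      using Suc.prems(2) that by simp
  qed
  then have "lex_least ((gen_c, True) # c_power n @ w)"
  proof (rule lex_least_Cons)
    show "(gen_c, True) \<in> set K_alphabet" by (simp add: K_alphabet_def)
    fix g e assume "((g, e), (gen_c, True)) \<in> list_order K_alphabet"
    then have "(g, e) = (gen_a, True)" using less_gen_c by blast
    then show "\<not> length_bound (letter_act (g, \<not> e) (word_elem ((gen_c, True) # c_power n @ w)))
        (int (length (c_power n @ w)))"
      using Suc.prems assms(2,3) by (auto simp: letter_act_funpow)
  qed
  then show ?case by simp
qed

text \<open>With x = 0, undoing a letter a, c or d leaves |x| + |y| at least |y|, and 2|y| + |x-y|
  at least 3|y| - 2, where y on the right is the old value. The letter t competes only against u and
  is excluded by the last hypothesis.\<close>

lemma lex_least_t_u: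
  assumes w: "lex_least w" and s: "s \<in> {(gen_t, True), (gen_u, True)}"
    and elem: "word_elem (s # w) = ((0, y), h)" "h \<noteq> (0, 0)"
    and len: "\<bar>y\<bar> + 2 * t_cost h > 2 * int (length w)"
    and u: "h = (1, 1) \<Longrightarrow> w = [] \<or> 3 * \<bar>y\<bar> > 2 * int (length w)"
    and t: "s = (gen_u, True) \<Longrightarrow>
      \<not> length_bound (letter_act (gen_t, False) ((0, y), h)) (int (length w))"
  shows "lex_least (s # w)"
proof (rule lex_least_Cons[OF w])
  show "s \<in> set K_alphabet" using s by (auto simp: K_alphabet_def)
  fix g e assume "((g, e), s) \<in> list_order K_alphabet"
  then have "g \<noteq> gen_u" "g = gen_t \<Longrightarrow> e \<and> s = (gen_u, True)"
    using s by (auto simp: K_alphabet_def)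
  show "\<not> length_bound (letter_act (g, \<not> e) (word_elem (s # w))) (int (length w))"
  proof (cases "g = gen_t")
    case True
    then show ?thesis
      using t \<open>g = gen_t \<Longrightarrow> e \<and> s = (gen_u, True)\<close> elem(1) by simp
  next
    case False
    have abs_step: "\<bar>z\<bar> \<le> \<bar>z + 1\<bar> + 1" "\<bar>z\<bar> \<le> \<bar>z - 1\<bar> + 1" "\<bar>z\<bar> \<le> \<bar>z + 2\<bar> + 2"
      "\<bar>z\<bar> \<le> \<bar>z - 2\<bar> + 2" for z :: int
      by arith+
    have neg: "\<bar>- 1 - y\<bar> = \<bar>y + 1\<bar>" "\<bar>1 - y\<bar> = \<bar>y - 1\<bar>" "\<bar>- 2 - y\<bar> = \<bar>y + 2\<bar>" "\<bar>2 - y\<bar> = \<bar>y - 2\<bar>"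
      by arith+
    obtain x' y' where xy: "letter_act (g, \<not> e) (word_elem (s # w)) = ((x', y'), h)"
      "\<bar>y\<bar> \<le> \<bar>x'\<bar> + \<bar>y'\<bar>" "3 * \<bar>y\<bar> \<le> 2 * \<bar>y'\<bar> + \<bar>x' - y'\<bar> + 2"
    proof (cases g)
      case gen_a
      show ?thesis
        using that[of "if e then - 1 else 1" y] abs_step[of y] elem
        by (cases e) (simp_all add: gen_a neg)
    next
      case gen_c
      show ?thesis
        using that[of "if e then - 2 else 2" y] abs_step[of y] elem
        by (cases e) (simp_all add: gen_c neg)
    next
      case gen_d
      show ?thesis
        using that[of "if e then - 1 else 1" "if e then y - 1 else y + 1"] abs_step[of y] elem
        by (cases e) (simp_all add: gen_d)
    qed (use False \<open>g \<noteq> gen_u\<close> in simp_all)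
    define a b where "a = \<bar>x'\<bar> + \<bar>y'\<bar>" and "b = 2 * \<bar>y'\<bar> + \<bar>x' - y'\<bar>"
    have "b \<ge> 0" by (simp add: b_def)
    note xy' = xy(2,3)[folded a_def b_def]
    show ?thesis
      unfolding xy(1) length_bound.simps a_def[symmetric] b_def[symmetric]
    proof (intro notI, elim disjE conjE)
      \<comment> \<open>If \<open>w\<close> is empty this contradicts \<open>b \<ge> 0\<close>;
        otherwise it gives 3|y| <= 2 \<open>length w\<close>, against \<open>u\<close>.\<close>
      assume "h = (1, 1)" "b + 2 \<le> 2 * int (length w)"
      with u xy' \<open>b \<ge> 0\<close> show False by auto
    qed (use xy' elem(2) len in simp_all)
  qed
qed

text \<open>The margin 2 comes from the last application of \<open>lex_least_c_power\<close>: with y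
  = 2m and a suffix of length m + 3 it demands 6m >= 4n + 2(m + 3), that is 2m >= 2n + 3.\<close>

lemma lex_least_long_word:
  assumes "m \<ge> n + 2"
  shows "lex_least (long_word n m)"
proof -
  let ?t = "(gen_t, True)" and ?u = "(gen_u, True)"
  have "lex_least [?u]"
    by (rule lex_least_t_u[OF lex_least_Nil, where y = 0 and h = "(1, 1)"]) (simp_all add: t_cost_def)
  then have "lex_least [?t, ?u]"
    by (rule lex_least_t_u[where y = 0 and h = "(3, 0)"]) (simp_all add: t_cost_def)
  then have "lex_least (c_power m @ [?t, ?u])"
    by (rule lex_least_c_power[where x = 0 and y = 0 and h = "(3, 0)"]) (simp_all add: t_cost_def)
  then have "lex_least (?t # c_power m @ [?t, ?u])"
    by (rule lex_least_t_u[where y = "2 * int m" and h = "(1, 1)"])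
      (use assms in \<open>simp_all add: t_cost_def letter_act_funpow\<close>)
  then have "lex_least (c_power n @ ?t # c_power m @ [?t, ?u])"
    by (rule lex_least_c_power[where x = 0 and y = "2 * int m" and h = "(1, 1)"])
      (use assms in \<open>simp_all add: t_cost_def letter_act_funpow\<close>)
  then show ?thesis by (simp add: long_word_def)
qed

text \<open>The nonempty suffixes have dihedral parts (0,1), (1,0) and (3,1), so the clauses for
  words without t never apply, and \<open>m\<close> and \<open>n\<close> are unrestricted.\<close>

lemma lex_least_conj_word: "lex_least (conj_word m n)"
proof -
  let ?t = "(gen_t, True)" and ?u = "(gen_u, True)"
  have "lex_least [?t]"
    by (rule lex_least_t_u[OF lex_least_Nil, where y = 0 and h = "(0, 1)"]) (simp_all add: t_cost_def)
  then have "lex_least [?u, ?t]"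
    by (rule lex_least_t_u[where y = 0 and h = "(1, 0)"]) (simp_all add: t_cost_def)
  then have "lex_least (c_power n @ [?u, ?t])"
    by (rule lex_least_c_power[where x = 0 and y = 0 and h = "(1, 0)"]) (simp_all add: t_cost_def)
  then have "lex_least (?t # c_power n @ [?u, ?t])"
    by (rule lex_least_t_u[where y = "2 * int n" and h = "(3, 1)"])
      (simp_all add: t_cost_def letter_act_funpow)
  then have "lex_least (c_power m @ ?t # c_power n @ [?u, ?t])"
    by (rule lex_least_c_power[where x = 0 and y = "2 * int n" and h = "(3, 1)"])
      (simp_all add: t_cost_def letter_act_funpow)
  then show ?thesis by (simp add: conj_word_def)
qed

section \<open>From formal words to words over the generating set\<close>

lemma K_genset_word_value:
  "v \<in> lists K_genset \<Longrightarrow> \<exists>w\<in>lists (set K_alphabet). v = K_word w \<and> word_value K_group v = K_class w"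
  by (auto simp: lists_K_genset word_value_K_word)

lemma K_word_in_lists: "w \<in> lists (set K_alphabet) \<Longrightarrow> K_word w \<in> lists K_genset"
  by (auto simp: lists_K_genset)

lemma lenlex_map:
  assumes "\<And>x y. (x, y) \<in> r \<Longrightarrow> (f x, f y) \<in> r'"
  shows "(v, w) \<in> lenlex r \<Longrightarrow> (map f v, map f w) \<in> lenlex r'"
proof (induction v arbitrary: w)
  case (Cons x v)
  then show ?case using assms by (cases w) (auto simp: Cons_lenlex_iff)
qed auto

lemma shortlex_least_K_word:
  assumes "w \<in> lists (set K_alphabet)" "K_class w \<in> S"
    and "\<And>v. v \<in> lists (set K_alphabet) \<Longrightarrow> K_class v \<in> S \<Longrightarrow> v \<noteq> w \<Longrightarrow>
      (w, v) \<in> lenlex (list_order K_alphabet)"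
  shows "shortlex_least K_group K_genset (list_order K_letters) S = K_word w"
proof (rule shortlex_least_eqI)
  show "asym (list_order K_letters)"
    by (rule asym_list_order[OF distinct_K_letters])
  show "K_word w \<in> lists K_genset" "word_value K_group (K_word w) \<in> S"
    using assms K_word_in_lists by (auto simp: word_value_K_word)
  fix v assume "v \<in> lists K_genset" "word_value K_group v \<in> S" "v \<noteq> K_word w"
  then obtain v' where v': "v' \<in> lists (set K_alphabet)" "v = K_word v'" "K_class v' \<in> S" "v' \<noteq> w"
    using K_genset_word_value[of v] by metis
  show "(K_word w, v) \<in> lenlex (list_order K_letters)"
    unfolding v'(2)
    by (rule lenlex_map[OF _ assms(3)[OF v'(1,3,4)]])
      (simp only: K_letters_eq list_order_map[where f = "\<lambda>s. K_class [s]"])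
qed

lemma shortlex_least_K_class:
  assumes "lex_least w" and "\<And>v. word_elem v = word_elem w \<Longrightarrow> length w \<le> length v"
  shows "shortlex_least K_group K_genset (list_order K_letters) {K_class w} = K_word w"
proof (rule shortlex_least_K_word)
  fix v assume v: "v \<in> lists (set K_alphabet)" "K_class v \<in> {K_class w}" "v \<noteq> w"
  then have "word_elem v = word_elem w" by (simp add: K_class_eq_iff)
  with v assms show "(w, v) \<in> lenlex (list_order K_alphabet)"
    by (cases "length v = length w") (force simp: lex_least_def lenlex_conv)+
qed (use assms(1) in \<open>auto simp: lex_least_def\<close>)

lemma word_length_K_class:
  assumes "w \<in> lists (set K_alphabet)" and "\<And>v. word_elem v = word_elem w \<Longrightarrow> length w \<le> length v"
  shows "word_length K_group K_genset (K_class w) = length w"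
proof -
  have "word_length K_group K_genset (K_class w) = length (K_word w)"
  proof (rule word_length_eqI)
    fix v assume "v \<in> lists K_genset" "word_value K_group v = K_class w"
    then obtain v' where "v = K_word v'" "word_elem v' = word_elem w"
      using K_genset_word_value[of v] K_class_eq_iff by metis
    then show "length (K_word w) \<le> length v" using assms(2) by simp
  qed (use assms(1) K_word_in_lists in \<open>auto simp: word_value_K_word\<close>)
  then show ?thesis by simp
qed

section \<open>Conjugacy classes and inclusions between the languages\<close>

lemma (in group) conj_class_refl: "g \<in> carrier G \<Longrightarrow> g \<in> conj_class G g"
  unfolding conj_class_def by (rule CollectI, rule exI[of _ "\<one>"]) simp

lemma (in group) conj_class_trans:
  assumes "g \<in> carrier G" "h \<in> conj_class G g" "k \<in> conj_class G h"
  shows "k \<in> conj_class G g"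
proof -
  obtain x y where x: "x \<in> carrier G" "h = x \<otimes> g \<otimes> inv x"
    and y: "y \<in> carrier G" "k = y \<otimes> h \<otimes> inv y"
    using assms unfolding conj_class_def by blast
  then have "k = (y \<otimes> x) \<otimes> g \<otimes> inv (y \<otimes> x)"
    using assms(1) by (simp add: inv_mult_group m_assoc)
  then show ?thesis using x y unfolding conj_class_def by blast
qed

lemma (in group) conj_class_sym:
  assumes "g \<in> carrier G" "h \<in> conj_class G g"
  shows "g \<in> conj_class G h"
proof -
  obtain x where x: "x \<in> carrier G" "h = x \<otimes> g \<otimes> inv x"
    using assms(2) unfolding conj_class_def by blast
  then have "g = inv x \<otimes> h \<otimes> inv (inv x)"
    using assms(1) by (simp add: m_assoc inv_solve_left)
  then show ?thesis using x(1) unfolding conj_class_def by blast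
qed

lemma (in group) conj_length_le: "g \<in> carrier G \<Longrightarrow> conj_length G X g \<le> word_length G X g"
  unfolding conj_length_def by (rule Least_le) (use conj_class_refl in blast)

text \<open>The chain |g|_c <= |g| <= l(w) collapses when its ends agree.\<close>

lemma (in group) ConjGeo_subset_Geo:
  assumes "\<And>w. w \<in> lists X \<Longrightarrow> word_value G w \<in> carrier G"
  shows "ConjGeo G X \<subseteq> Geo G X"
  unfolding ConjGeo_def Geo_def
  using assms conj_length_le word_length_le by (auto intro!: antisym) fastforce+

lemma SL_subset_Geo: "SL K_group K_genset (list_order K_letters) \<subseteq> Geo K_group K_genset"
proof
  fix w assume "w \<in> SL K_group K_genset (list_order K_letters)"
  then obtain g where g: "g \<in> carrier K_group"
      "w = shortlex_least K_group (set K_letters) (list_order K_letters) {g}"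
    unfolding SL_def K_genset_def by blast
  obtain v where v: "v \<in> lists K_genset" "word_value K_group v = g"
    using K_group_represented[OF g(1)] K_word_in_lists word_value_K_word by metis
  note least = shortlex_least_properties[OF distinct_K_letters, of _ K_group "{g}",
      folded g(2) K_genset_def]
  have "word_length K_group K_genset g = length w"
    using least v by (intro word_length_eqI) auto
  moreover have "w \<in> lists K_genset" "word_value K_group w = g"
    using least v by auto
  ultimately show "w \<in> Geo K_group K_genset"
    by (simp add: Geo_def)
qed

text \<open>Since u acts trivially, conjugating by translations changes nothing. The centralizer of
  u in the dihedral group consists of the elements with an even number of factors t; all others send
  u to tut and swap the coordinates.\<close>

lemma conj_class_long_word:
  assumes "word_elem w = ((x, y), (1, 1))"
  shows "K_class v \<in> conj_class K_group (K_class w) \<longleftrightarrow>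
    word_elem v = ((x, y), (1, 1)) \<or> word_elem v = ((y, x), (3, 1))"
proof
  assume "K_class v \<in> conj_class K_group (K_class w)"
  then obtain z where "K_class v = K_class z \<otimes>\<^bsub>K_group\<^esub> K_class w \<otimes>\<^bsub>K_group\<^esub> inv\<^bsub>K_group\<^esub> K_class z"
    unfolding conj_class_def carrier_K_group by blast
  \<comment> \<open>Conjugacy in the form vz = zw, so that no inverse has to be computed in the
    model.\<close>
  then have "K_class v \<otimes>\<^bsub>K_group\<^esub> K_class z = K_class z \<otimes>\<^bsub>K_group\<^esub> K_class w"
    by (simp add: K.m_assoc)
  then have "word_elem (v @ z) = word_elem (z @ w)"
    by (simp only: K_class_mult K_class_eq_iff)
  then have eq: "word_elem v \<otimes>\<^bsub>K_model\<^esub> word_elem z = word_elem z \<otimes>\<^bsub>K_model\<^esub> word_elem w"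
    by (simp only: word_elem_append)
  obtain x1 y1 h1 where v: "word_elem v = ((x1, y1), h1)" by (metis prod.collapse)
  obtain x2 y2 h2 where z: "word_elem z = ((x2, y2), h2)" by (metis prod.collapse)
  have "h1 \<in> D8_set" "h2 \<in> D8_set" "(1, 1) \<in> D8_set"
    using word_elem_closed[of v] word_elem_closed[of z] by (simp_all add: v z D8_set_def)
  then show "word_elem v = ((x, y), (1, 1)) \<or> word_elem v = ((y, x), (3, 1))"
    using eq unfolding v z assms
    by (elim D8_cases) (auto simp: mult_K_model mult_dihedral_group_4 D8_set_def K_action_def)
next
  let ?t = "K_class [(gen_t, True)]"
  assume "word_elem v = ((x, y), (1, 1)) \<or> word_elem v = ((y, x), (3, 1))"
  then consider "K_class v = K_class w" | "K_class v = K_class ([(gen_t, True)] @ w @ [(gen_t, False)])"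
    using word_elem_append[of w "[(gen_t, False)]"] assms
    by (auto simp: K_class_eq_iff mult_K_model mult_dihedral_group_4 D8_set_def K_action_def)
  then show "K_class v \<in> conj_class K_group (K_class w)"
  proof cases
    case 1
    then show ?thesis by (simp add: K.conj_class_refl)
  next
    case 2
    then have "K_class v = ?t \<otimes>\<^bsub>K_group\<^esub> K_class w \<otimes>\<^bsub>K_group\<^esub> inv\<^bsub>K_group\<^esub> ?t"
      by (simp add: K_class_mult K_class_inverse_letter)
    then show ?thesis unfolding conj_class_def using K_class_closed by blast
  qed
qed

section \<open>The languages\<close>

text \<open>A spelling without t needs at least 3m - n + 1 letters, which is at least n + m + 3
  because m > n; a spelling with t needs n + m + 3 in any case.\<close>

lemma length_long_word_le:
  assumes "m > n" "word_elem v = word_elem (long_word n m)"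
  shows "length (long_word n m) \<le> length v"
  using length_bound[of v] assms
  by (simp add: word_elem_long_word t_cost_def) (auto simp: long_word_def)

lemma length_conj_word_le:
  assumes "word_elem v = word_elem (conj_word m n)"
  shows "length (conj_word m n) \<le> length v"
  using length_bound[of v] assms
  by (simp add: word_elem_conj_word t_cost_def) (auto simp: conj_word_def)

lemma length_conj_word: "length (conj_word m n) = length (long_word n m)"
  by (simp add: conj_word_def long_word_def)

lemma conj_class_long_word_iff:
  "K_class v \<in> conj_class K_group (K_class (long_word n m)) \<longleftrightarrow>
    word_elem v = word_elem (long_word n m) \<or> word_elem v = word_elem (conj_word m n)"
  using conj_class_long_word[OF word_elem_long_word]
  by (simp add: word_elem_long_word word_elem_conj_word)

lemma long_word_in_lists: "long_word n m \<in> lists (set K_alphabet)"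
  by (auto simp: long_word_def K_alphabet_def)

lemma conj_word_in_lists: "conj_word m n \<in> lists (set K_alphabet)"
  by (auto simp: conj_word_def K_alphabet_def)

lemma long_word_shorter:
  assumes "m \<le> n"
  obtains v where "v \<in> lists (set K_alphabet)" "word_elem v = word_elem (long_word n m)"
    "length v < length (long_word n m)"
proof
  \<comment> \<open>Its length is 2m + (n - m) + 1 = n + m + 1, two less than that of
    \<open>long_word n m\<close>.\<close>
  let ?v = "replicate (2 * m) (gen_d, True) @ replicate (n - m) (gen_c, True) @ [(gen_u, True)]"
  show "?v \<in> lists (set K_alphabet)"
    by (auto simp: K_alphabet_def)
  show "word_elem ?v = word_elem (long_word n m)"
    using assms by (simp add: word_elem_long_word letter_act_funpow)
  show "length ?v < length (long_word n m)"
    using assms by (simp add: long_word_def)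
qed

lemma long_word_notin_Geo:
  assumes "m \<le> n"
  shows "K_word (long_word n m) \<notin> Geo K_group K_genset"
proof
  assume geo: "K_word (long_word n m) \<in> Geo K_group K_genset"
  obtain v where v: "v \<in> lists (set K_alphabet)" "word_elem v = word_elem (long_word n m)"
    "length v < length (long_word n m)"
    using long_word_shorter[OF assms] by blast
  then have "K_class (long_word n m) = K_class v"
    by (simp add: K_class_eq_iff)
  then have "word_length K_group K_genset (K_class (long_word n m)) \<le> length v"
    using word_length_le[OF K_word_in_lists[OF v(1)], of K_group] by (simp add: word_value_K_word)
  then show False
    using geo v(3) by (simp add: Geo_def word_value_K_word)
qed

lemma word_length_long_word:
  assumes "m > n"
  shows "word_length K_group K_genset (K_class (long_word n m)) = length (long_word n m)"
  using assms by (intro word_length_K_class length_long_word_le long_word_in_lists)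

text \<open>The class has just two elements, and both have length n + m + 3.\<close>

lemma conj_length_long_word:
  assumes "m > n"
  shows "conj_length K_group K_genset (K_class (long_word n m)) = length (long_word n m)"
  unfolding conj_length_def
proof (rule Least_equality)
  show "\<exists>h\<in>conj_class K_group (K_class (long_word n m)).
      word_length K_group K_genset h = length (long_word n m)"
    using K.conj_class_refl[OF K_class_closed] word_length_long_word[OF assms] by blast
  fix k assume "\<exists>h\<in>conj_class K_group (K_class (long_word n m)). word_length K_group K_genset h = k"
  then obtain h where h: "h \<in> conj_class K_group (K_class (long_word n m))"
    "word_length K_group K_genset h = k" by blast
  have "h \<in> carrier K_group"
    using h(1) unfolding conj_class_def by auto
  then obtain v where v: "v \<in> lists (set K_alphabet)" "h = K_class v"
    using K_group_represented by blast
  then have "word_elem v = word_elem (long_word n m) \<or> word_elem v = word_elem (conj_word m n)"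
    using h(1) conj_class_long_word_iff by simp
  then have le: "length (long_word n m) \<le> length z" if "word_elem z = word_elem v" for z
    by (metis that length_long_word_le[OF assms] length_conj_word_le length_conj_word)
  have "\<exists>z\<in>lists K_genset. word_value K_group z = h \<and> length z = k"
    unfolding h(2)[symmetric] word_length_def
    by (rule LeastI_ex) (use v K_word_in_lists word_value_K_word in blast)
  then obtain z where "K_class z = h" "length z = k"
    using K_genset_word_value by (metis length_map)
  then show "length (long_word n m) \<le> k"
    using le[of z] by (simp only: v(2) K_class_eq_iff)
qed

lemma long_word_in_languages:
  assumes "m \<ge> n + 2"
  shows "K_word (long_word n m) \<in> Geo K_group K_genset"
    and "K_word (long_word n m) \<in> ConjGeo K_group K_genset"
    and "K_word (long_word n m) \<in> SL K_group K_genset (list_order K_letters)"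
    and "K_word (long_word n m) \<in> ConjMinLenSL K_group K_genset (list_order K_letters)"
proof -
  have "K_word (long_word n m) \<in> lists K_genset"
    by (rule K_word_in_lists[OF long_word_in_lists])
  then show "K_word (long_word n m) \<in> Geo K_group K_genset"
    and "K_word (long_word n m) \<in> ConjGeo K_group K_genset"
    using assms by (simp_all add: Geo_def ConjGeo_def word_value_K_word
        word_length_long_word conj_length_long_word)
  have "shortlex_least K_group K_genset (list_order K_letters) {K_class (long_word n m)}
      = K_word (long_word n m)"
    using assms by (intro shortlex_least_K_class lex_least_long_word length_long_word_le) auto
  moreover have "word_length K_group K_genset (K_class (long_word n m))
      = conj_length K_group K_genset (K_class (long_word n m))"
    using assms by (simp add: word_length_long_word conj_length_long_word)
  ultimately show "K_word (long_word n m) \<in> SL K_group K_genset (list_order K_letters)"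
    and "K_word (long_word n m) \<in> ConjMinLenSL K_group K_genset (list_order K_letters)"
    unfolding SL_def ConjMinLenSL_def using K_class_closed by (metis (mono_tags, lifting) mem_Collect_eq)+
qed

text \<open>The two elements of the class have equal length, and each has its least word. These
  words first differ after c^n, where \<open>conj_word m n\<close> continues with c and
  \<open>long_word n m\<close> with the larger letter t.\<close>

lemma conj_word_in_ConjSL:
  assumes "m \<ge> n + 2"
  shows "K_word (conj_word m n) \<in> ConjSL K_group K_genset (list_order K_letters)"
proof -
  let ?\<kappa> = "conj_class K_group (K_class (long_word n m))"
  have trans: "trans (lenlex (list_order K_alphabet))"
    by (intro lenlex_transI trans_list_order) (simp add: K_alphabet_def)
  have irrefl: "irrefl (list_order K_alphabet)"
    and less_c: "((gen_c, True), (gen_t, True)) \<in> list_order K_alphabet"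
    by (simp_all add: K_alphabet_def irrefl_def)
  have "m = n + Suc (m - n - 1)" using assms by simp
  then have "c_power m = c_power n @ (gen_c, True) # c_power (m - n - 1)"
    by (metis replicate_Suc replicate_add)
  then have less: "(conj_word m n, long_word n m) \<in> lenlex (list_order K_alphabet)"
    using assms less_c by (simp add: conj_word_def long_word_def lenlex_append2[OF irrefl] Cons_lenlex_iff)
  have "shortlex_least K_group K_genset (list_order K_letters) ?\<kappa> = K_word (conj_word m n)"
  proof (rule shortlex_least_K_word)
    show "conj_word m n \<in> lists (set K_alphabet)"
      by (rule conj_word_in_lists)
    show "K_class (conj_word m n) \<in> ?\<kappa>"
      by (simp add: conj_class_long_word_iff)
    fix v assume v: "v \<in> lists (set K_alphabet)" "K_class v \<in> ?\<kappa>" "v \<noteq> conj_word m n"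
    show "(conj_word m n, v) \<in> lenlex (list_order K_alphabet)"
    proof (cases "length v = length (conj_word m n)")
      case False
      then have "length (conj_word m n) < length v"
        using v(2) assms length_long_word_le[of n m v] length_conj_word_le[of v m n]
        by (auto simp: conj_class_long_word_iff length_conj_word)
      then show ?thesis by (simp add: lenlex_conv)
    next
      case True
      show ?thesis
      proof (cases "word_elem v = word_elem (conj_word m n)")
        case conj: True
        then show ?thesis
          using lex_least_conj_word[of m n] v True by (simp add: lex_least_def)
      next
        case False
        then have "v = long_word n m \<or> (long_word n m, v) \<in> lenlex (list_order K_alphabet)"
          using lex_least_long_word[OF assms] v True
          by (auto simp: conj_class_long_word_iff lex_least_def length_conj_word)
        then show ?thesis using less trans by (auto dest: transD)
      qed
    qed
  qed
  then show ?thesis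
    unfolding ConjSL_def
    by (intro CollectI exI[of _ ?\<kappa>] conjI imageI K_class_closed) simp
qed

text \<open>A shortlex representative is shortest in its class, but for m <= n the conjugate element
  represented by \<open>long_word n m\<close> has a shorter spelling.\<close>

lemma conj_word_notin_ConjSL:
  assumes "m \<le> n"
  shows "K_word (conj_word m n) \<notin> ConjSL K_group K_genset (list_order K_letters)"
proof
  assume "K_word (conj_word m n) \<in> ConjSL K_group K_genset (list_order K_letters)"
  then obtain g where g: "g \<in> carrier K_group" and eq: "K_word (conj_word m n)
      = shortlex_least K_group (set K_letters) (list_order K_letters) (conj_class K_group g)"
    unfolding ConjSL_def K_genset_def by blast
  note least = shortlex_least_properties[OF distinct_K_letters, of _ K_group "conj_class K_group g",
      folded eq K_genset_def, unfolded word_value_K_word]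
  obtain w where "w \<in> lists K_genset" "word_value K_group w \<in> conj_class K_group g"
    using K_group_represented[OF g] K.conj_class_refl[OF g] K_word_in_lists word_value_K_word by metis
  then have "K_class (conj_word m n) \<in> conj_class K_group g"
    by (rule least(2))
  have long: "K_class (long_word n m) \<in> conj_class K_group (K_class (conj_word m n))"
  proof -
    have "K_class (conj_word m n) \<in> conj_class K_group (K_class (long_word n m))"
      by (simp add: conj_class_long_word_iff)
    then show ?thesis by (rule K.conj_class_sym[OF K_class_closed])
  qed
  obtain v where v: "v \<in> lists (set K_alphabet)" "word_elem v = word_elem (long_word n m)"
    "length v < length (long_word n m)"
    using long_word_shorter[OF assms] by blast
  then have "K_class v = K_class (long_word n m)"
    by (simp add: K_class_eq_iff)
  then have "K_class v \<in> conj_class K_group g"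
    using K.conj_class_trans[OF g \<open>K_class (conj_word m n) \<in> conj_class K_group g\<close>] long by simp
  then have "length (conj_word m n) \<le> length v"
    using least(3)[OF K_word_in_lists[OF v(1)]] by (simp add: word_value_K_word)
  then show False using v(3) by (simp add: length_conj_word)
qed

text \<open>One argument for four languages: all lie inside \<open>Geo\<close> and contain
  \<open>long_word n m\<close> whenever m >= n + 2.\<close>

lemma not_regular_long_word:
  assumes "\<And>n m. m \<ge> n + 2 \<Longrightarrow> K_word (long_word n m) \<in> L"
    and "L \<subseteq> Geo K_group K_genset"
  shows "\<not> regular_language K_genset L"
proof (rule not_regular_language)
  fix i j :: nat assume "i < j"
  \<comment> \<open>Doubling the exponents turns i < j into the gap 2i + 2 <= 2j. The suffix with 2j
    is accepted after the prefix for i and rejected after the one for j.\<close>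
  let ?p = "\<lambda>i. K_word (c_power (2 * i) @ [(gen_t, True)])"
  let ?s = "K_word (c_power (2 * j) @ [(gen_t, True), (gen_u, True)])"
  have p: "?p k @ ?s = K_word (long_word (2 * k) (2 * j))" for k
    by (simp add: long_word_def)
  have "K_word (long_word (2 * i) (2 * j)) \<in> L"
    using \<open>i < j\<close> by (intro assms) simp
  moreover have "K_word (long_word (2 * j) (2 * j)) \<notin> L"
    using long_word_notin_Geo assms(2) by blast
  moreover have "K_word (long_word (2 * k) (2 * j)) \<in> lists K_genset" for k
    by (rule K_word_in_lists[OF long_word_in_lists])
  ultimately show "\<exists>s. ?p i @ s \<in> lists K_genset \<and> ?p j @ s \<in> lists K_genset \<and>
      (?p i @ s \<in> L \<longleftrightarrow> ?p j @ s \<notin> L)"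
    by (intro exI[of _ ?s]) (simp only: p simp_thms)
qed

lemma not_regular_ConjSL:
  "\<not> regular_language K_genset (ConjSL K_group K_genset (list_order K_letters))" (is "\<not> regular_language _ ?L")
proof (rule not_regular_language)
  fix i j :: nat assume "i < j"
  let ?p = "\<lambda>i. K_word (c_power (2 * i) @ [(gen_t, True)])"
  \<comment> \<open>Here the leading exponent must be the larger one, so the suffix takes 2i: it is
    accepted after the prefix for j and rejected after the one for i.\<close>
  let ?s = "K_word (c_power (2 * i) @ [(gen_u, True), (gen_t, True)])"
  have p: "?p k @ ?s = K_word (conj_word (2 * k) (2 * i))" for k
    by (simp add: conj_word_def)
  have "K_word (conj_word (2 * j) (2 * i)) \<in> ?L"
    using \<open>i < j\<close> by (intro conj_word_in_ConjSL) simp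
  moreover have "K_word (conj_word (2 * i) (2 * i)) \<notin> ?L"
    by (rule conj_word_notin_ConjSL) simp
  moreover have "K_word (conj_word (2 * k) (2 * i)) \<in> lists K_genset" for k
    by (rule K_word_in_lists[OF conj_word_in_lists])
  ultimately show "\<exists>s. ?p i @ s \<in> lists K_genset \<and> ?p j @ s \<in> lists K_genset \<and>
      (?p i @ s \<in> ?L \<longleftrightarrow> ?p j @ s \<notin> ?L)"
    by (intro exI[of _ ?s]) (simp only: p simp_thms)
qed

theorem proposition5p4:
  shows "(\<exists>\<phi> \<in> hom (dihedral_group 4) (AutoGroup (integer_group \<times>\<times> integer_group)).
            K_group \<cong> semidirect_product (integer_group \<times>\<times> integer_group) \<phi> (dihedral_group 4)) \<and>
         generate K_group K_genset = carrier K_group \<and>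
         \<not> regular_language K_genset (Geo K_group K_genset) \<and>
         \<not> regular_language K_genset (ConjGeo K_group K_genset) \<and>
         \<not> regular_language K_genset (SL K_group K_genset (list_order K_letters)) \<and>
         \<not> regular_language K_genset (ConjMinLenSL K_group K_genset (list_order K_letters)) \<and>
         \<not> regular_language K_genset (ConjSL K_group K_genset (list_order K_letters))"
proof (intro conjI)
  have "K_group \<cong> K_model"
    using K_coord_iso by (auto simp: is_iso_def)
  then show "\<exists>\<phi> \<in> hom (dihedral_group 4) (AutoGroup (integer_group \<times>\<times> integer_group)).
      K_group \<cong> semidirect_product (integer_group \<times>\<times> integer_group) \<phi> (dihedral_group 4)"
    using K_action_hom unfolding K_model_def by blast
  show "generate K_group K_genset = carrier K_group"
    by (rule generate_K_genset)
  have "word_value K_group w \<in> carrier K_group" if "w \<in> lists K_genset" for w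
    using K_genset_word_value[OF that] by auto
  then have ConjGeo: "ConjGeo K_group K_genset \<subseteq> Geo K_group K_genset"
    by (rule K.ConjGeo_subset_Geo)
  have ConjMinLenSL: "ConjMinLenSL K_group K_genset (list_order K_letters) \<subseteq> Geo K_group K_genset"
    using SL_subset_Geo by (auto simp: ConjMinLenSL_def SL_def)
  show "\<not> regular_language K_genset (Geo K_group K_genset)"
    by (rule not_regular_long_word[OF long_word_in_languages(1) order_refl])
  show "\<not> regular_language K_genset (ConjGeo K_group K_genset)"
    by (rule not_regular_long_word[OF long_word_in_languages(2) ConjGeo])
  show "\<not> regular_language K_genset (SL K_group K_genset (list_order K_letters))"
    by (rule not_regular_long_word[OF long_word_in_languages(3) SL_subset_Geo])
  show "\<not> regular_language K_genset (ConjMinLenSL K_group K_genset (list_order K_letters))"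
    by (rule not_regular_long_word[OF long_word_in_languages(4) ConjMinLenSL])
  show "\<not> regular_language K_genset (ConjSL K_group K_genset (list_order K_letters))"
    by (rule not_regular_ConjSL)
qed

end
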